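(* For any even integer $r \geq 2$ there exists $N = N(r)$ such that for every $n \geq N$, any $r$-colouring of $[3]^n$ contains a monochromatic combinatorial line whose set of active coordinates is the union of at most $r-1$ intervals of $\{1,\dots,n\}$.
   Context: For natural numbers $m,n$, $[m]=\{1,\dots,m\}$ and $[m]^n$ is the set of words of length $n$ over the alphabet $[m]$. Let $[m]^n_{\star} = ([m]\cup\{\star\})^n \setminus [m]^n$; the coordinates of $\ell \in [m]^n_\star$ at which the symbol $\star$ occurs are called active (there is at least one). For $\alpha\in[m]$, $\ell[\alpha]\in[m]^n$ is the word obtained from $\ell$ by replacing every $\star$ by $\alpha$. The set $\{\ell[1],\dots,\ell[m]\}$ is called a combinatorial line in $[m]^n$ (identified with $\ell$). It is monochromatic under a colouring of $[m]^n$ if all $m$ words $\ell[1],\dots,\ell[m]$ receive the same colour. An interval of $\{1,\dots,n\}$ is a set of consecutive integers in $\{1,\dots,n\}$. *)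

theory Defs
  imports Main "HOL-Library.FuncSet"
begin

definition words :: "nat \<Rightarrow> nat \<Rightarrow> (nat \<Rightarrow> nat) set" where
  "words m n = {1..n} \<rightarrow>\<^sub>E {1..m}"

text \<open>In a word with stars, \<open>None\<close> plays the role of the symbol \<open>\<star>\<close>.\<close>

definition star_words :: "nat \<Rightarrow> nat \<Rightarrow> (nat \<Rightarrow> nat option) set" where
  "star_words m n =
     ({1..n} \<rightarrow>\<^sub>E insert None (Some ` {1..m})) - ({1..n} \<rightarrow>\<^sub>E Some ` {1..m})"

definition active :: "nat \<Rightarrow> (nat \<Rightarrow> nat option) \<Rightarrow> nat set" where
  "active n l = {i \<in> {1..n}. l i = None}"

definition fill :: "nat \<Rightarrow> (nat \<Rightarrow> nat option) \<Rightarrow> nat \<Rightarrow> (nat \<Rightarrow> nat)" where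
  "fill n l a = (\<lambda>i\<in>{1..n}. case l i of None \<Rightarrow> a | Some b \<Rightarrow> b)"

definition comb_line :: "nat \<Rightarrow> nat \<Rightarrow> (nat \<Rightarrow> nat option) \<Rightarrow> (nat \<Rightarrow> nat) set" where
  "comb_line m n l = fill n l ` {1..m}"

definition monochromatic :: "('a \<Rightarrow> 'b) \<Rightarrow> 'a set \<Rightarrow> bool" where
  "monochromatic c L \<longleftrightarrow> (\<exists>k. \<forall>w\<in>L. c w = k)"

definition interval_of :: "nat \<Rightarrow> nat set \<Rightarrow> bool" where
  "interval_of n I \<longleftrightarrow> (\<exists>a b. 1 \<le> a \<and> a \<le> b \<and> b \<le> n \<and> I = {a..b})"

definition union_of_at_most_intervals :: "nat \<Rightarrow> nat \<Rightarrow> nat set \<Rightarrow> bool" where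
  "union_of_at_most_intervals k n S \<longleftrightarrow>
     (\<exists>F. finite F \<and> card F \<le> k \<and> (\<forall>I\<in>F. interval_of n I) \<and> S = \<Union>F)"

end

theory Submission
  imports "HOL-Library.Ramsey" Defs
begin

text \<open>
  By Ramsey's theorem for hypergraphs one may assume that the colour of a word that is constant on
  few blocks depends only on its sequence of block letters, with equal neighbours merged. So one
  colours finite sequences \<open>w\<close> over \<open>{1, 2, 3}\<close> through \<open>remdups_adj w\<close>, and looks for a pattern with at
  most \<open>r - 1\<close> stars. Suppose there is none.

  In a pattern \<open>a \<star> b\<close> the fillings \<open>a\<close> and \<open>b\<close> agree, and the third filling inserts the
  third letter \<open>c\<close>. Hence inserting between 1 and \<open>r - 1\<close> letters \<open>c\<close> into gaps between \<open>a\<close> and \<open>b\<close> always changes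
  the colour. As there are only \<open>r\<close> colours, the colour depends just on the numbers of inserted
  1s, 2s and 3s modulo \<open>r\<close>: it is a function \<open>M\<close> on \<open>(\<int>/r)\<^sup>3\<close> that is bijective on each axis-parallel line.

  Take a point \<open>v\<close> and a colour other than its own; it occurs at distances \<open>a, b, c \<in> {1..r-1}\<close> from \<open>v\<close>
  in the three axis directions. Patterns with stars of type \<open>a \<star> b\<close> exclude \<open>a + b + c < r\<close>, and those with
  some stars of type \<open>a \<star> a\<close> exclude \<open>a + b \<ge> r\<close>, \<open>a + c \<ge> r\<close>, \<open>a + b + c < 2 r\<close> and its rotations.
  A double counting argument over the torus, by induction on the distance of a coordinate
  from 0 modulo \<open>r\<close>, turns these inequalities into \<open>r dvd a + b + c\<close>.
  Summing over all colours other than that of \<open>v\<close> gives \<open>r dvd 3 r (r - 1) / 2\<close>, so \<open>r\<close> is odd.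
\<close>

section \<open>Latin colourings of the three-dimensional torus\<close>

text \<open>The last two clauses express the absence of lines; only the first direction is distinguished.\<close>

definition dir_ok :: "int \<Rightarrow> (int \<Rightarrow> int \<Rightarrow> int \<Rightarrow> nat) \<Rightarrow> bool" where
  "dir_ok r M \<longleftrightarrow>
     (\<forall>x y z. M x y z \<in> {1..nat r}) \<and>
     (\<forall>x y z. M (x + r) y z = M x y z) \<and>
     (\<forall>x y z a. 0 < a \<longrightarrow> a < r \<longrightarrow> M (x + a) y z \<noteq> M x y z) \<and>
     (\<forall>x y z a b c. 0 < a \<longrightarrow> 0 < b \<longrightarrow> 0 < c \<longrightarrow> a + b + c < r \<longrightarrow>
        \<not> (M (x + a) y z = M x (y + b) z \<and> M (x + a) y z = M x y (z + c))) \<and>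
     (\<forall>x y z a b c. a < r \<longrightarrow> b < r \<longrightarrow> c < r \<longrightarrow> r \<le> a + b \<longrightarrow> r \<le> a + c \<longrightarrow> a + b + c < 2 * r \<longrightarrow>
        \<not> (M (x + a) y z = M x (y + b) z \<and> M (x + a) y z = M x y (z + c)))"

lemma
  assumes "dir_ok r M"
  shows dir_ok_range: "M x y z \<in> {1..nat r}"
    and dir_ok_period: "M (x + r) y z = M x y z"
    and dir_ok_neq: "0 < a \<Longrightarrow> a < r \<Longrightarrow> M (x + a) y z \<noteq> M x y z"
    and dir_ok_small: "0 < a \<Longrightarrow> 0 < b \<Longrightarrow> 0 < c \<Longrightarrow> a + b + c < r \<Longrightarrow>
        \<not> (M (x + a) y z = M x (y + b) z \<and> M (x + a) y z = M x y (z + c))"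
    and dir_ok_large: "a < r \<Longrightarrow> b < r \<Longrightarrow> c < r \<Longrightarrow> r \<le> a + b \<Longrightarrow> r \<le> a + c \<Longrightarrow> a + b + c < 2 * r \<Longrightarrow>
        \<not> (M (x + a) y z = M x (y + b) z \<and> M (x + a) y z = M x y (z + c))"
  using assms unfolding dir_ok_def by simp_all

lemma dir_ok_mult:
  assumes "dir_ok r M"
  shows "M (x + k * r) y z = M x y z"
proof (induction k rule: int_induct[where k = 0])
  case base
  then show ?case by simp
next
  case (step1 i)
  have "M (x + (i + 1) * r) y z = M ((x + i * r) + r) y z" by (simp add: algebra_simps)
  then show ?case using dir_ok_period[OF assms] step1 by simp
next
  case (step2 i)
  have "M (x + i * r) y z = M ((x + (i - 1) * r) + r) y z" by (simp add: algebra_simps)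
  then show ?case using dir_ok_period[OF assms] step2 by simp
qed

lemma dir_ok_cong:
  assumes "dir_ok r M" "x mod r = x' mod r"
  shows "M x y z = M x' y z"
proof -
  obtain k where "x = x' + k * r"
    using assms(2) by (metis add.commute mod_eqE mult.commute)
  then show ?thesis using dir_ok_mult[OF assms(1)] by simp
qed

text \<open>An injection of \<open>r\<close> offsets into \<open>r\<close> colours is surjective.
  The unique offset is the distance to colour \<open>k\<close> that is counted later.\<close>

lemma dir_ok_ex1:
  assumes ok: "dir_ok r M" and "r > 0" and k: "k \<in> {1..nat r}"
  shows "\<exists>!a. 0 \<le> a \<and> a < r \<and> M (x + a) y z = k"
proof -
  have inj: "inj_on (\<lambda>a. M (x + a) y z) {0..<r}"
  proof (rule linorder_inj_onI)
    fix a b :: int assume "a < b" "a \<in> {0..<r}" "b \<in> {0..<r}"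
    then have "M ((x + a) + (b - a)) y z \<noteq> M (x + a) y z"
      by (intro dir_ok_neq[OF ok]) auto
    then show "M (x + a) y z \<noteq> M (x + b) y z" by simp
  qed auto
  have "(\<lambda>a. M (x + a) y z) ` {0..<r} = {1..nat r}"
  proof (rule card_subset_eq)
    show "(\<lambda>a. M (x + a) y z) ` {0..<r} \<subseteq> {1..nat r}"
      using dir_ok_range[OF ok] by blast
    show "card ((\<lambda>a. M (x + a) y z) ` {0..<r}) = card {1..nat r}"
      using card_image[OF inj] by simp
  qed simp
  then have "k \<in> (\<lambda>a. M (x + a) y z) ` {0..<r}" using k by simp
  then obtain a where "a \<in> {0..<r}" "M (x + a) y z = k" by blast
  moreover have "b = a" if "0 \<le> b \<and> b < r \<and> M (x + b) y z = k" for b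
    using inj_onD[OF inj, of b a] that \<open>a \<in> {0..<r}\<close> \<open>M (x + a) y z = k\<close> by simp
  ultimately show ?thesis by (intro ex1I[of _ a]) simp_all
qed

section \<open>Distances to a colour in the three directions\<close>

definition tripod :: "int \<Rightarrow> (int \<Rightarrow> int \<Rightarrow> int \<Rightarrow> nat) \<Rightarrow> int \<Rightarrow> int \<Rightarrow> int \<Rightarrow> int \<Rightarrow> int \<Rightarrow> int \<Rightarrow> bool" where
  "tripod r M x y z a b c \<longleftrightarrow> a \<in> {1..<r} \<and> b \<in> {1..<r} \<and> c \<in> {1..<r} \<and>
     M (x + a) y z = M x (y + b) z \<and> M (x + a) y z = M x y (z + c)"

text \<open>For \<open>0 < a < r\<close>: the distance from \<open>a\<close> to the nearest multiple
  of \<open>r\<close> is below \<open>t\<close>.\<close>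

definition near :: "int \<Rightarrow> int \<Rightarrow> int \<Rightarrow> bool" where
  "near r t a \<longleftrightarrow> a < t \<or> r - t < a"

text \<open>Since \<open>dir_ok\<close> singles out the first direction, it is demanded for all
  cyclic rotations; each argument can then be made for one direction only.\<close>

locale latin_torus =
  fixes r :: int and M :: "int \<Rightarrow> int \<Rightarrow> int \<Rightarrow> nat"
  assumes r2: "r \<ge> 2"
    and ok1: "dir_ok r M"
    and ok2: "dir_ok r (\<lambda>x y z. M z x y)"
    and ok3: "dir_ok r (\<lambda>x y z. M y z x)"
begin

lemma rotate: "latin_torus r (\<lambda>x y z. M z x y)"
  using r2 ok1 ok2 ok3 by unfold_locales

lemma M_cong:
  assumes "x mod r = x' mod r" "y mod r = y' mod r" "z mod r = z' mod r"
  shows "M x y z = M x' y' z'"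
  using dir_ok_cong[OF ok1 assms(1), of y z] dir_ok_cong[OF ok2 assms(2), of x' z]
    dir_ok_cong[OF ok3 assms(3), of x' y'] by simp

lemma tripod_ge: "tripod r M x y z a b c \<Longrightarrow> r \<le> a + b + c"
  using dir_ok_small[OF ok1, of a b c x y z] unfolding tripod_def by force

lemma tripod_ge2: "tripod r M x y z a b c \<Longrightarrow> r \<le> a + b \<Longrightarrow> r \<le> a + c \<Longrightarrow> 2 * r \<le> a + b + c"
  using dir_ok_large[OF ok1, of a b c x y z] unfolding tripod_def by force

text \<open>
  Fix a colour and let \<open>A\<close>, \<open>B\<close>, \<open>C\<close> be the distances to it in the three directions. The points
  \<open>V (r - t)\<close> with \<open>A = r - t\<close> are matched with those in \<open>V t\<close> in two ways: by \<open>f\<close>, the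
  opposite corner of the rectangle in the first two directions, and by \<open>g\<close>, likewise in the first and
  third direction. Since \<open>g\<close> replaces \<open>C\<close> by \<open>r - C\<close>, the sum of \<open>C v + C (f v) - r\<close> over
  \<open>V (r - t)\<close> vanishes, while every summand is nonnegative.
\<close>

lemma tripod_dvd_step:
  assumes known: "\<And>x y z a b c. tripod r M x y z a b c \<Longrightarrow> near r t a \<or> near r t b \<or> near r t c
                      \<Longrightarrow> r dvd a + b + c"
    and t: "0 < t" "2 * t < r"
    and tri: "tripod r M x0 y0 z0 a0 b0 c0" and a0: "a0 = t \<or> a0 = r - t"
  shows "r dvd a0 + b0 + c0"
proof -
  define k where "k = M (x0 + a0) y0 z0"
  have k: "k \<in> {1..nat r}" using dir_ok_range[OF ok1] unfolding k_def .
  have rp: "r > 0" using r2 by simp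
  define A where "A = (\<lambda>(x,y,z). THE a. 0 \<le> a \<and> a < r \<and> M (x + a) y z = k)"
  define B where "B = (\<lambda>(x,y,z). THE a. 0 \<le> a \<and> a < r \<and> M x (y + a) z = k)"
  define C where "C = (\<lambda>(x,y,z). THE a. 0 \<le> a \<and> a < r \<and> M x y (z + a) = k)"
  have A: "0 \<le> A (x,y,z) \<and> A (x,y,z) < r \<and> M (x + A (x,y,z)) y z = k" for x y z
    unfolding A_def using theI'[OF dir_ok_ex1[OF ok1 rp k]] by simp
  have B: "0 \<le> B (x,y,z) \<and> B (x,y,z) < r \<and> M x (y + B (x,y,z)) z = k" for x y z
    unfolding B_def using theI'[OF dir_ok_ex1[OF ok2 rp k]] by simp
  have C: "0 \<le> C (x,y,z) \<and> C (x,y,z) < r \<and> M x y (z + C (x,y,z)) = k" for x y z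
    unfolding C_def using theI'[OF dir_ok_ex1[OF ok3 rp k]] by simp
  have A_eq: "A (x,y,z) = a" if "0 \<le> a" "a < r" "M (x + a) y z = k" for x y z a
    unfolding A_def prod.case using that by (intro the1_equality[OF dir_ok_ex1[OF ok1 rp k, of x y z]]) simp
  have B_eq: "B (x,y,z) = a" if "0 \<le> a" "a < r" "M x (y + a) z = k" for x y z a
    unfolding B_def prod.case using that by (intro the1_equality[OF dir_ok_ex1[OF ok2 rp k, of x y z]]) simp
  have C_eq: "C (x,y,z) = a" if "0 \<le> a" "a < r" "M x y (z + a) = k" for x y z a
    unfolding C_def prod.case using that by (intro the1_equality[OF dir_ok_ex1[OF ok3 rp k, of x y z]]) simp
  have modadd: "(u mod r + v) mod r = (u + v) mod r" for u v by (simp add: mod_simps)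
  \<comment> \<open>Distances depend only on residues, so \<open>box\<close> below represents the
    whole torus.\<close>
  have A_mod: "A (x mod r, y mod r, z mod r) = A (x,y,z)" for x y z
  proof (rule A_eq)
    have "M (x mod r + A (x,y,z)) (y mod r) (z mod r) = M (x + A (x,y,z)) y z"
      by (rule M_cong) (simp_all add: modadd)
    then show "M (x mod r + A (x,y,z)) (y mod r) (z mod r) = k" using A[of x y z] by simp
  qed (use A[of x y z] in auto)
  have B_mod: "B (x mod r, y mod r, z mod r) = B (x,y,z)" for x y z
  proof (rule B_eq)
    have "M (x mod r) (y mod r + B (x,y,z)) (z mod r) = M x (y + B (x,y,z)) z"
      by (rule M_cong) (simp_all add: modadd)
    then show "M (x mod r) (y mod r + B (x,y,z)) (z mod r) = k" using B[of x y z] by simp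
  qed (use B[of x y z] in auto)
  have C_mod: "C (x mod r, y mod r, z mod r) = C (x,y,z)" for x y z
  proof (rule C_eq)
    have "M (x mod r) (y mod r) (z mod r + C (x,y,z)) = M x y (z + C (x,y,z))"
      by (rule M_cong) (simp_all add: modadd)
    then show "M (x mod r) (y mod r) (z mod r + C (x,y,z)) = k" using C[of x y z] by simp
  qed (use C[of x y z] in auto)
  \<comment> \<open>A distance is 0 only where the point itself has colour \<open>k\<close>, so the
    three distances vanish together.\<close>
  have pos: "A (x,y,z) > 0 \<and> B (x,y,z) > 0 \<and> C (x,y,z) > 0"
    if "A (x,y,z) > 0 \<or> B (x,y,z) > 0 \<or> C (x,y,z) > 0" for x y z
  proof -
    have "M x y z \<noteq> k"
      using that A_eq[of 0 x y z] B_eq[of 0 x y z] C_eq[of 0 x y z] rp by force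
    then show ?thesis using A[of x y z] B[of x y z] C[of x y z]
      by (metis add.right_neutral order_le_less)
  qed
  have tripod: "tripod r M x y z (A (x,y,z)) (B (x,y,z)) (C (x,y,z))" if "A (x,y,z) > 0" for x y z
    using pos[of x y z] that A[of x y z] B[of x y z] C[of x y z] unfolding tripod_def by auto
  define box where "box = {0..<r} \<times> {0..<r} \<times> {0..<r}"
  define V where "V = (\<lambda>s. {v \<in> box. A v = s})"
  define f where "f = (\<lambda>(x,y,z). ((x + A (x,y,z)) mod r, (y + B (x,y,z)) mod r, z))"
  define g where "g = (\<lambda>(x,y,z). ((x + A (x,y,z)) mod r, y, (z + C (x,y,z)) mod r))"
  have finV: "finite (V s)" for s unfolding V_def box_def by simp
  \<comment> \<open>The other two corners of the rectangle spanned by \<open>v\<close> and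
    \<open>f v\<close> have colour \<open>k\<close>. From \<open>f v\<close> they are reached by
    going back \<open>A v\<close> or \<open>B v\<close>, that is, forward \<open>r - A v\<close> or
    \<open>r - B v\<close>.\<close>
  have f: "A (f (x,y,z)) = r - A (x,y,z) \<and> B (f (x,y,z)) = r - B (x,y,z)
      \<and> f (x,y,z) \<in> box \<and> f (f (x,y,z)) = (x,y,z)"
    if v: "(x,y,z) \<in> box" "A (x,y,z) > 0" for x y z
  proof -
    let ?a = "A (x,y,z)" and ?b = "B (x,y,z)"
    have p: "?a > 0" "?b > 0" using pos v by auto
    have z: "z mod r = z" "y mod r = y" "x mod r = x" using v unfolding box_def by auto
    have "A (x + ?a, y + ?b, z) = r - ?a"
    proof (rule A_eq)
      show "M (x + ?a + (r - ?a)) (y + ?b) z = k"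
        using B[of x y z] M_cong[of "x + ?a + (r - ?a)" x "y + ?b" "y + ?b" z z] by simp
    qed (use A[of x y z] p in auto)
    moreover have "B (x + ?a, y + ?b, z) = r - ?b"
    proof (rule B_eq)
      show "M (x + ?a) (y + ?b + (r - ?b)) z = k"
        using A[of x y z] M_cong[of "x + ?a" "x + ?a" "y + ?b + (r - ?b)" y z z] by simp
    qed (use B[of x y z] p in auto)
    ultimately have *: "A (f (x,y,z)) = r - ?a" "B (f (x,y,z)) = r - ?b"
      using A_mod[of "x + ?a" "y + ?b" z] B_mod[of "x + ?a" "y + ?b" z] z unfolding f_def by auto
    have "f (f (x,y,z)) = (x,y,z)"
      using * z unfolding f_def by (auto simp: modadd)
    then show ?thesis using * v rp unfolding f_def box_def by auto
  qed
  have g: "A (g (x,y,z)) = r - A (x,y,z) \<and> C (g (x,y,z)) = r - C (x,y,z)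
      \<and> g (x,y,z) \<in> box \<and> g (g (x,y,z)) = (x,y,z)"
    if v: "(x,y,z) \<in> box" "A (x,y,z) > 0" for x y z
  proof -
    let ?a = "A (x,y,z)" and ?b = "C (x,y,z)"
    have p: "?a > 0" "?b > 0" using pos v by auto
    have z: "z mod r = z" "y mod r = y" "x mod r = x" using v unfolding box_def by auto
    have "A (x + ?a, y, z + ?b) = r - ?a"
    proof (rule A_eq)
      show "M (x + ?a + (r - ?a)) y (z + ?b) = k"
        using C[of x y z] M_cong[of "x + ?a + (r - ?a)" x y y "z + ?b" "z + ?b"] by simp
    qed (use A[of x y z] p in auto)
    moreover have "C (x + ?a, y, z + ?b) = r - ?b"
    proof (rule C_eq)
      show "M (x + ?a) y (z + ?b + (r - ?b)) = k"
        using A[of x y z] M_cong[of "x + ?a" "x + ?a" y y "z + ?b + (r - ?b)" z] by simp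
    qed (use C[of x y z] p in auto)
    ultimately have *: "A (g (x,y,z)) = r - ?a" "C (g (x,y,z)) = r - ?b"
      using A_mod[of "x + ?a" y "z + ?b"] C_mod[of "x + ?a" y "z + ?b"] z unfolding g_def by auto
    have "g (g (x,y,z)) = (x,y,z)"
      using * z unfolding g_def by (auto simp: modadd)
    then show ?thesis using * v rp unfolding g_def box_def by auto
  qed
  have fV: "f v \<in> V (r - s) \<and> f (f v) = v \<and> B (f v) = r - B v" if "v \<in> V s" "0 < s" for v s
    using that f unfolding V_def by (cases v) auto
  have gV: "g v \<in> V (r - s) \<and> g (g v) = v \<and> C (g v) = r - C v" if "v \<in> V s" "0 < s" for v s
    using that g unfolding V_def by (cases v) auto
  have reindex_f: "(\<Sum>v\<in>V (r - t). C (f v)) = (\<Sum>v\<in>V t. C v)"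
    by (rule sum.reindex_bij_witness[where i = f and j = f]) (use fV[of _ t] fV[of _ "r - t"] t in auto)
  have reindex_g: "(\<Sum>v\<in>V (r - t). C (g v)) = (\<Sum>v\<in>V t. C v)"
    by (rule sum.reindex_bij_witness[where i = g and j = g]) (use gV[of _ t] gV[of _ "r - t"] t in auto)
  have "(\<Sum>v\<in>V (r - t). C v + C (f v) - r) = (\<Sum>v\<in>V (r - t). C v + C (g v) - r)"
    by (simp add: sum.distrib sum_subtractf reindex_f reindex_g)
  also have "\<dots> = 0" using gV[of _ "r - t"] t by (intro sum.neutral) auto
  finally have zero: "(\<Sum>v\<in>V (r - t). C v + C (f v) - r) = 0" .
  have main: "C v + C (f v) \<ge> r \<and> (C v + C (f v) = r \<longrightarrow>
      r dvd (r - t) + B v + C v \<and> r dvd t + B (f v) + C (f v))" if v: "v \<in> V (r - t)" for v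
  proof -
    obtain x y z where xyz: "v = (x,y,z)" by (cases v)
    obtain x' y' z' where xyz': "f v = (x',y',z')" by (cases "f v")
    have fv: "f v \<in> V t" "B (f v) = r - B v" using fV[OF v] t by auto
    have T: "tripod r M x y z (r - t) (B v) (C v)"
      using tripod[of x y z] v t unfolding xyz V_def by auto
    have T': "tripod r M x' y' z' t (B (f v)) (C (f v))"
      using tripod[of x' y' z'] fv(1) t unfolding xyz' V_def by auto
    have rng: "0 < B v" "B v < r" "0 < C v" "C v < r" "0 < C (f v)" "C (f v) < r"
      using T T' unfolding tripod_def by auto
    consider "B v < t" | "B v \<ge> t" "C v < t" | "B v \<ge> t" "C v \<ge> t" by linarith
    then show ?thesis
    proof cases
      \<comment> \<open>Here \<open>B (f v) = r - B v\<close> exceeds \<open>r - t\<close>, so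
        \<open>known\<close> applies at both points. Size bounds leave only the multiples
        \<open>r\<close> and \<open>2 * r\<close>, and adding these gives
        \<open>C v + C (f v) = r\<close>.\<close>
      case 1
      have d: "r dvd (r - t) + B v + C v" "r dvd t + B (f v) + C (f v)"
        using known[OF T] known[OF T'] 1 fv(2) unfolding near_def by auto
      obtain i where i: "(r - t) + B v + C v = r * i" using d(1) by blast
      have "r * i < r * 2" "r * 0 < r * i" using i 1 rng t by linarith+
      then have "i = 1" using mult_less_cancel_left_pos[OF rp, of i 2] mult_less_cancel_left_pos[OF rp, of 0 i] by linarith
      obtain j where j: "t + B (f v) + C (f v) = r * j" using d(2) by blast
      have "r * j < r * 3" "r * 1 < r * j" using j 1 rng t fv(2) by linarith+
      then have "j = 2" using mult_less_cancel_left_pos[OF rp, of j 3] mult_less_cancel_left_pos[OF rp, of 1 j] by linarith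
      have "C v + C (f v) = r" using i j \<open>i = 1\<close> \<open>j = 2\<close> fv(2) by simp
      then show ?thesis using d by simp
    next
      \<comment> \<open>Impossible: the sum is a multiple of \<open>r\<close> strictly between
        \<open>r\<close> and \<open>2 * r\<close>.\<close>
      case 2
      have d: "r dvd (r - t) + B v + C v"
        using known[OF T] 2 unfolding near_def by auto
      obtain i where i: "(r - t) + B v + C v = r * i" using d(1) by blast
      have "r * i < r * 2" "r * 1 < r * i" using i 2 rng t by linarith+
      then have False using mult_less_cancel_left_pos[OF rp, of i 2] mult_less_cancel_left_pos[OF rp, of 1 i] by linarith
      then show ?thesis ..
    next
      \<comment> \<open>The two sums add up to \<open>2 * r + C v + C (f v)\<close>, their lower
        bounds to \<open>3 * r\<close>; equality forces both bounds to be attained.\<close>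
      case 3
      have "2 * r \<le> (r - t) + B v + C v" using tripod_ge2[OF T] 3 by simp
      moreover have "r \<le> t + B (f v) + C (f v)" using tripod_ge[OF T'] .
      ultimately have "C v + C (f v) \<ge> r"
        "C v + C (f v) = r \<Longrightarrow> (r - t) + B v + C v = 2 * r \<and> t + B (f v) + C (f v) = r"
        using fv(2) by linarith+
      then show ?thesis by (metis dvd_refl dvd_triv_right)
    qed
  qed
  have eq: "C v + C (f v) = r" if "v \<in> V (r - t)" for v
  proof -
    have "\<forall>v\<in>V (r - t). C v + C (f v) - r = 0"
      using sum_nonneg_eq_0_iff[of "V (r - t)" "\<lambda>v. C v + C (f v) - r", OF finV] main zero by simp
    then show ?thesis using that by simp
  qed
  have concl: "r dvd s + B v + C v" if "v \<in> V s" "s = t \<or> s = r - t" for v s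
    using that(2)
  proof
    assume s: "s = t"
    then have "f v \<in> V (r - t)" "f (f v) = v" using fV[of v t] that t by auto
    then show ?thesis using main[of "f v"] eq[of "f v"] s by simp
  next
    assume s: "s = r - t"
    then show ?thesis using main[of v] eq[of v] that by simp
  qed
  have e: "A (x0,y0,z0) = a0" "B (x0,y0,z0) = b0" "C (x0,y0,z0) = c0"
    using tri A_eq[of a0 x0 y0 z0] B_eq[of b0 x0 y0 z0] C_eq[of c0 x0 y0 z0] unfolding tripod_def k_def by simp_all
  have "(x0 mod r, y0 mod r, z0 mod r) \<in> V a0"
    unfolding V_def box_def using e A_mod[of x0 y0 z0] rp by simp
  from concl[OF this a0] show ?thesis unfolding B_mod C_mod e .
qed

lemma tripod_rotate: "tripod r (\<lambda>x y z. M z x y) x y z a b c \<longleftrightarrow> tripod r M z x y c a b"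
  unfolding tripod_def by auto

text \<open>A coordinate that is near for \<open>Suc t\<close> but not for \<open>t\<close> equals
  \<open>t\<close> or \<open>r - t\<close>. A rotation brings it to the first place, where
  \<open>tripod_dvd_step\<close> applies.\<close>

lemma tripod_dvd_near:
  "2 * int t \<le> r + 1 \<Longrightarrow> tripod r M x y z a b c \<Longrightarrow>
     near r (int t) a \<or> near r (int t) b \<or> near r (int t) c \<Longrightarrow> r dvd a + b + c"
proof (induction t arbitrary: x y z a b c)
  case 0
  then show ?case unfolding near_def tripod_def by auto
next
  case (Suc t)
  interpret R: latin_torus r "\<lambda>x y z. M z x y" by (rule rotate)
  interpret R2: latin_torus r "\<lambda>x y z. M y z x" by (rule R.rotate)
  show ?case
  proof (cases "near r (int t) a \<or> near r (int t) b \<or> near r (int t) c")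
    case True
    then show ?thesis using Suc.IH[OF _ Suc.prems(2)] Suc.prems(1) by simp
  next
    case False
    have "t \<noteq> 0" using Suc.prems(2,3) unfolding near_def tripod_def by auto
    then have t: "0 < int t" "2 * int t < r" using Suc.prems(1) by auto
    have IH: "r dvd a + b + c" if "tripod r M x y z a b c"
      "near r (int t) a \<or> near r (int t) b \<or> near r (int t) c" for x y z a b c
      using Suc.IH that t by auto
    have IH1: "r dvd a + b + c" if "tripod r (\<lambda>x y z. M z x y) x y z a b c"
      "near r (int t) a \<or> near r (int t) b \<or> near r (int t) c" for x y z a b c
      using IH[of z x y c a b] that tripod_rotate by (auto simp: ac_simps)
    have IH2: "r dvd a + b + c" if "tripod r (\<lambda>x y z. M y z x) x y z a b c"
      "near r (int t) a \<or> near r (int t) b \<or> near r (int t) c" for x y z a b c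
      using IH1[of z x y c a b] that R.tripod_rotate by (auto simp: ac_simps)
    have T1: "tripod r (\<lambda>x y z. M z x y) y z x b c a" using Suc.prems tripod_rotate by simp
    have T2: "tripod r (\<lambda>x y z. M y z x) z x y c a b" using T1 R.tripod_rotate by simp
    consider "a = int t \<or> a = r - int t" | "b = int t \<or> b = r - int t" | "c = int t \<or> c = r - int t"
      using Suc.prems(3) False unfolding near_def by auto
    then show ?thesis
    proof cases
      case 1 then show ?thesis using tripod_dvd_step[OF IH t Suc.prems(2)] by simp
    next
      case 2
      have "r dvd b + c + a" by (rule R.tripod_dvd_step[OF _ t T1 2]) (rule IH1)
      then show ?thesis by (simp add: ac_simps)
    next
      case 3
      have "r dvd c + a + b" by (rule R2.tripod_dvd_step[OF _ t T2 3]) (rule IH2)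
      then show ?thesis by (simp add: ac_simps)
    qed
  qed
qed

lemma odd_order: "odd r"
proof
  assume ev: "even r"
  then obtain h where h: "r = 2 * h" by blast
  have rp: "r > 0" using r2 by simp
  have dvd: "r dvd a + b + c" if T: "tripod r M x y z a b c" for x y z a b c
  proof (cases "near r h a \<or> near r h b \<or> near r h c")
    case True
    then show ?thesis using tripod_dvd_near[of "nat h", OF _ T] h rp by simp
  next
    \<comment> \<open>Only distances all equal to \<open>h\<close> remain. As
      \<open>h + h = r\<close>, \<open>tripod_ge2\<close> would require \<open>3 * h\<close> to be
      at least \<open>2 * r\<close>.\<close>
    case False
    then have "a = h" "b = h" "c = h" using h unfolding near_def by auto
    then show ?thesis using tripod_ge2[OF T] h rp by simp
  qed
  define K where "K = {1..nat r} - {M 0 0 0}"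
  define A where "A = (\<lambda>k. THE a. 0 \<le> a \<and> a < r \<and> M (0 + a) 0 0 = k)"
  define B where "B = (\<lambda>k. THE a. 0 \<le> a \<and> a < r \<and> M 0 (0 + a) 0 = k)"
  define C where "C = (\<lambda>k. THE a. 0 \<le> a \<and> a < r \<and> M 0 0 (0 + a) = k)"
  have A: "0 \<le> A k \<and> A k < r \<and> M (0 + A k) 0 0 = k" if "k \<in> K" for k
    unfolding A_def using that unfolding K_def by (intro theI'[OF dir_ok_ex1[OF ok1 rp]]) simp
  have B: "0 \<le> B k \<and> B k < r \<and> M 0 (0 + B k) 0 = k" if "k \<in> K" for k
    unfolding B_def using that unfolding K_def by (intro theI'[OF dir_ok_ex1[OF ok2 rp]]) simp
  have C: "0 \<le> C k \<and> C k < r \<and> M 0 0 (0 + C k) = k" if "k \<in> K" for k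
    unfolding C_def using that unfolding K_def by (intro theI'[OF dir_ok_ex1[OF ok3 rp]]) simp
  have nz: "A k \<noteq> 0" "B k \<noteq> 0" "C k \<noteq> 0" if "k \<in> K" for k
    using A[OF that] B[OF that] C[OF that] that unfolding K_def by (metis Diff_iff add_0 singletonI)+
  have cardK: "card K = card {1..<r}"
    using dir_ok_range[OF ok1, of 0 0 0] rp unfolding K_def by (subst card_Diff_singleton) auto
  \<comment> \<open>As the colour varies, each direction runs through the distances 1 to
    \<open>r - 1\<close> exactly once.\<close>
  have sum_eq: "(\<Sum>k\<in>K. f k) = \<Sum>{1..<r}" if inj: "inj_on f K" and "f ` K \<subseteq> {1..<r}" for f
  proof -
    have "f ` K = {1..<r}" using that cardK card_image[OF inj] by (intro card_subset_eq) auto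
    then show ?thesis using sum.reindex[OF inj, of id] by simp
  qed
  have "(\<Sum>k\<in>K. A k) = \<Sum>{1..<r}"
    using A nz by (intro sum_eq inj_onI subsetI) (metis, force)
  moreover have "(\<Sum>k\<in>K. B k) = \<Sum>{1..<r}"
    using B nz by (intro sum_eq inj_onI subsetI) (metis, force)
  moreover have "(\<Sum>k\<in>K. C k) = \<Sum>{1..<r}"
    using C nz by (intro sum_eq inj_onI subsetI) (metis, force)
  ultimately have s: "(\<Sum>k\<in>K. A k + B k + C k) = 3 * \<Sum>{1..<r}" by (simp add: sum.distrib)
  have "r dvd (\<Sum>k\<in>K. A k + B k + C k)"
  proof (rule dvd_sum)
    fix k assume k: "k \<in> K"
    show "r dvd A k + B k + C k"
      using A[OF k] B[OF k] C[OF k] nz[OF k] by (intro dvd[of 0 0 0]) (auto simp: tripod_def)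
  qed
  moreover have gauss: "2 * \<Sum>{1..<1 + int n} = int n * (int n + 1)" for n
  proof (induction n)
    case (Suc n)
    have "{1..<1 + int (Suc n)} = insert (1 + int n) {1..<1 + int n}" by auto
    then show ?case using Suc by (simp add: algebra_simps)
  qed simp
  have "2 * \<Sum>{1..<r} = (r - 1) * r" using gauss[of "nat (r - 1)"] rp by simp
  then have "\<Sum>{1..<r} = (r - 1) * h" using h by simp
  ultimately have "2 * h dvd 3 * (r - 1) * h" using s h by (simp add: ac_simps)
  then have "2 dvd 3 * (r - 1)" using h rp by (simp only: dvd_times_right_cancel_iff)
  then show False using ev by presburger
qed

end

section \<open>Set functions separating nearby nested sets\<close>

text \<open>Both functions exhaust the \<open>r\<close> colours, so the value at \<open>i\<close> is
  the one colour missed by the common remaining values.\<close>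

lemma last_value:
  fixes f g :: "nat \<Rightarrow> nat"
  assumes "\<And>j. j < r \<Longrightarrow> f j \<in> {1..r}" "\<And>j. j < r \<Longrightarrow> g j \<in> {1..r}"
    and "inj_on f {..<r}" "inj_on g {..<r}"
    and "i < r" and eq: "\<And>j. j < r \<Longrightarrow> j \<noteq> i \<Longrightarrow> f j = g j"
  shows "f i = g i"
proof -
  have full: "h ` {..<r} = {1..r}" if "inj_on h {..<r}" "\<And>j. j < r \<Longrightarrow> h j \<in> {1..r}" for h :: "nat \<Rightarrow> nat"
    using that card_image[OF that(1)] by (intro card_subset_eq) auto
  have "g i \<in> f ` {..<r}" using full[of f] assms by auto
  then obtain j where "j < r" "g i = f j" by auto
  moreover have "j = i"
  proof (rule ccontr)
    assume "j \<noteq> i"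
    then have "g j = g i" using eq[of j] calculation by simp
    then show False using inj_onD[OF assms(4), of j i] calculation \<open>j \<noteq> i\<close> \<open>i < r\<close> by simp
  qed
  ultimately show ?thesis by simp
qed

text \<open>In the application \<open>D\<close> is a set of gaps and \<open>K\<close> consists of
  those that carry an insertion. The goal is \<open>cong_card\<close>: only the cardinality modulo
  \<open>r\<close> matters while \<open>r\<close> elements stay free.\<close>

locale nested_colouring =
  fixes r :: nat and D :: "'a set" and \<phi> :: "'a set \<Rightarrow> nat"
  assumes r2: "2 \<le> r" and fin: "finite D"
    and range: "K \<subseteq> D \<Longrightarrow> \<phi> K \<in> {1..r}"
    and nested: "K \<subseteq> K' \<Longrightarrow> K' \<subseteq> D \<Longrightarrow> 1 \<le> card (K' - K) \<Longrightarrow> card (K' - K) < r \<Longrightarrow> \<phi> K \<noteq> \<phi> K'"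
begin

lemma chain_inj:
  assumes "distinct xs" "set xs \<subseteq> D - H" "H \<subseteq> D" "i < j" "j \<le> length xs" "j - i < r"
  shows "\<phi> (H \<union> set (take i xs)) \<noteq> \<phi> (H \<union> set (take j xs))"
proof -
  have "take j xs = take i xs @ drop i (take j xs)"
    by (metis append_take_drop_id min.absorb1 assms(4) less_imp_le take_take)
  then have s: "set (take j xs) = set (take i xs) \<union> set (drop i (take j xs))"
    by (metis set_append)
  have "distinct (take j xs)" using assms(1) by simp
  then have d: "set (take i xs) \<inter> set (drop i (take j xs)) = {}" "distinct (drop i (take j xs))"
    using \<open>take j xs = take i xs @ drop i (take j xs)\<close> by (metis distinct_append)+
  have DH: "set (take j xs) \<subseteq> D - H" using assms(2) set_take_subset by fastforce
  have "(H \<union> set (take j xs)) - (H \<union> set (take i xs)) = set (drop i (take j xs))"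
    using s d DH by auto
  then have "card ((H \<union> set (take j xs)) - (H \<union> set (take i xs))) = j - i"
    using distinct_card[OF d(2)] assms(5) by simp
  then show ?thesis using assms s DH by (intro nested) auto
qed

text \<open>In a chain of \<open>r + 1\<close> sets, the first \<open>r\<close> and the last
  \<open>r\<close> both show every colour once and share \<open>r - 1\<close> sets, so the two end
  sets agree in colour.\<close>

lemma period:
  assumes "K \<subseteq> K'" "K' \<subseteq> D" "card (K' - K) = r"
  shows "\<phi> K = \<phi> K'"
proof -
  obtain xs where xs: "set xs = K' - K" "distinct xs"
    using finite_distinct_list[of "K' - K"] fin assms(2) finite_subset by blast
  have len: "length xs = r" using distinct_card[OF xs(2)] xs(1) assms(3) by simp
  define f where "f = (\<lambda>j. \<phi> (K \<union> set (take j xs)))"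
  have ne: "f i \<noteq> f j" if "i < j" "j \<le> r" "j - i < r" for i j
    unfolding f_def using that assms xs len by (intro chain_inj) auto
  have rng: "f j \<in> {1..r}" for j
    unfolding f_def using assms xs set_take_subset[of j xs] by (intro range) auto
  \<comment> \<open>Updating \<open>f\<close> at 0 puts the window from 1 to \<open>r\<close> on the
    index set of the window from 0 to \<open>r - 1\<close>.\<close>
  have "f 0 = (f(0 := f r)) 0"
  proof (rule last_value[where r = r and f = f and g = "f(0 := f r)" and i = 0])
    show "inj_on f {..<r}" by (rule linorder_inj_onI) (auto simp: ne)
    show "inj_on (f(0 := f r)) {..<r}"
    proof (rule linorder_inj_onI)
      fix i j assume "i < j" "i \<in> {..<r}" "j \<in> {..<r}"
      then have "f i \<noteq> f j" "f j \<noteq> f r" using ne[of i j] ne[of j r] by simp_all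
      then show "(f(0 := f r)) i \<noteq> (f(0 := f r)) j" using \<open>i < j\<close> by auto
    qed auto
  qed (use rng r2 in auto)
  then show ?thesis using assms(1) xs len by (simp add: f_def Un_absorb1)
qed

text \<open>Two chains from \<open>H\<close> add \<open>a\<close> and \<open>b\<close> in opposite
  orders and then the same elements. They differ only at position 1, where \<open>last_value\<close>
  applies.\<close>

lemma exchange:
  assumes "insert a (insert b H) \<subseteq> D" "a \<notin> H" "b \<notin> H" "a \<noteq> b" "card H + r \<le> card D"
  shows "\<phi> (insert a H) = \<phi> (insert b H)"
proof -
  have finH: "finite H" using assms(1) finite_subset[OF _ fin, of H] by simp
  have "card (D - insert a (insert b H)) = card D - (card H + 2)"
    using assms fin finH by (subst card_Diff_subset) auto
  then have "r - 2 \<le> card (D - insert a (insert b H))" using assms(5) by simp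
  then obtain E where E: "E \<subseteq> D - insert a (insert b H)" "card E = r - 2"
    by (metis obtain_subset_with_card_n)
  then have "finite E" using fin finite_subset by blast
  then obtain es where es: "set es = E" "distinct es" using finite_distinct_list by blast
  have len: "length es = r - 2" using distinct_card[OF es(2)] es(1) E(2) by simp
  define f where "f = (\<lambda>ys j. \<phi> (H \<union> set (take j (ys @ es))))"
  have ne: "f ys i \<noteq> f ys j" if "i < j" "j < r" "ys = [a,b] \<or> ys = [b,a]" for i j ys
    unfolding f_def using that assms E es len by (intro chain_inj) auto
  have rng: "f ys j \<in> {1..r}" if "ys = [a,b] \<or> ys = [b,a]" for j ys
    unfolding f_def using that assms E es set_take_subset[of j "ys @ es"] by (intro range) auto
  have "f [a,b] 1 = f [b,a] 1"
  proof (rule last_value[where r = r and f = "f [a,b]" and g = "f [b,a]" and i = 1])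
    fix j assume "j < r" "j \<noteq> 1"
    then show "f [a,b] j = f [b,a] j"
      by (cases j; cases "j - 1") (auto simp: f_def insert_commute)
  next
    show "inj_on (f [a,b]) {..<r}" "inj_on (f [b,a]) {..<r}"
      by (rule linorder_inj_onI; auto simp: ne)+
  qed (use rng r2 in auto)
  then show ?thesis by (simp add: f_def)
qed

lemma same_card:
  assumes "K \<subseteq> D" "K' \<subseteq> D" "card K = card K'" "card K + r \<le> card D"
  shows "\<phi> K = \<phi> K'"
  using assms
proof (induction "card (K - K')" arbitrary: K rule: less_induct)
  case less
  have finK: "finite K" "finite K'" using less.prems fin finite_subset by blast+
  show ?case
  proof (cases "K = K'")
    case False
    have "\<not> K \<subseteq> K'" using False less.prems(3) finK card_subset_eq by blast
    moreover have "\<not> K' \<subseteq> K" using False less.prems(3) finK card_subset_eq by metis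
    ultimately obtain a b where ab: "a \<in> K" "a \<notin> K'" "b \<in> K'" "b \<notin> K" by blast
    let ?K = "insert b (K - {a})"
    have "\<phi> (insert a (K - {a})) = \<phi> ?K"
      using ab less.prems finK card_Diff1_le[of K a] by (intro exchange) auto
    moreover have "\<phi> ?K = \<phi> K'"
    proof (rule less.hyps)
      have "?K - K' = (K - K') - {a}" using ab by auto
      moreover have "card ((K - K') - {a}) < card (K - K')"
        using ab finK by (intro card_Diff1_less) auto
      ultimately show "card (?K - K') < card (K - K')" by simp
      have "card ?K = card K" using ab finK card.remove[of K a] by simp
      then show "card ?K = card K'" "card ?K + r \<le> card D" using less.prems by auto
    qed (use ab less.prems in auto)
    ultimately show ?thesis using ab by (simp add: insert_absorb)
  qed simp
qed

lemma cong_card_aux: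
  assumes "K \<subseteq> D" "K' \<subseteq> D" "card K' = card K + q * r" "card K' + r \<le> card D"
  shows "\<phi> K = \<phi> K'"
  using assms
proof (induction q arbitrary: K)
  case 0
  then show ?case using same_card[of K K'] by simp
next
  case (Suc q)
  have finK: "finite K" using Suc.prems fin finite_subset by blast
  have "card (D - K) = card D - card K" using Suc.prems(1) finK by (simp add: card_Diff_subset)
  then have "r \<le> card (D - K)" using Suc.prems(3,4) by simp
  then obtain E where E: "E \<subseteq> D - K" "card E = r" by (metis obtain_subset_with_card_n)
  have finE: "finite E" using E fin finite_subset by blast
  have disj: "E \<inter> K = {}" "(K \<union> E) - K = E" using E by auto
  have "\<phi> K = \<phi> (K \<union> E)" using E Suc.prems disj by (intro period) auto
  also have "\<dots> = \<phi> K'"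
  proof (rule Suc.IH)
    show "card K' = card (K \<union> E) + q * r"
      using Suc.prems(3) E finE finK disj by (subst card_Un_disjoint) auto
  qed (use E Suc.prems in auto)
  finally show ?case .
qed

lemma cong_card:
  assumes "K \<subseteq> D" "K' \<subseteq> D" "card K mod r = card K' mod r"
    "card K + r \<le> card D" "card K' + r \<le> card D"
  shows "\<phi> K = \<phi> K'"
proof -
  have *: "\<exists>q. y = x + q * r" if "x \<le> y" "x mod r = y mod r" for x y :: nat
    using that by (metis le_add_diff_inverse mod_eq_dvd_iff_nat dvd_def mult.commute)
  show ?thesis
  proof (cases "card K \<le> card K'")
    case True
    then show ?thesis using *[OF True assms(3)] cong_card_aux assms by blast
  next
    case False
    then show ?thesis using *[of "card K'" "card K"] cong_card_aux[of K' K] assms by force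
  qed
qed

end

section \<open>Colourings of sequences of blocks\<close>

lemma remdups_adj_append_left: "remdups_adj (remdups_adj u @ v) = remdups_adj (u @ v)"
proof (induction u rule: remdups_adj.induct)
  case (3 x y xs)
  show ?case
  proof (cases "x = y")
    case True
    then show ?thesis using 3 by simp
  next
    case False
    then have "remdups_adj (remdups_adj (x # y # xs) @ v) = remdups_adj (x # (remdups_adj (y # xs) @ v))" by simp
    also have "\<dots> = remdups_adj (x # ((y # xs) @ v))"
      using 3(2)[OF False] unfolding remdups_adj_Cons[of x] by simp
    finally show ?thesis by simp
  qed
qed simp_all

lemma remdups_adj_append_right: "remdups_adj (u @ remdups_adj v) = remdups_adj (u @ v)"
proof -
  have "rev (remdups_adj (u @ remdups_adj v)) = rev (remdups_adj (u @ v))"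
    using remdups_adj_append_left[of "rev v" "rev u"] by (simp flip: remdups_adj_rev)
  then show ?thesis by simp
qed

lemma remdups_adj_append_cong:
  assumes "remdups_adj u = remdups_adj u'" "remdups_adj v = remdups_adj v'"
  shows "remdups_adj (u @ v) = remdups_adj (u' @ v')"
  using assms by (metis remdups_adj_append_left remdups_adj_append_right)

definition row :: "nat \<Rightarrow> (nat \<Rightarrow> 'a list) \<Rightarrow> 'a list" where
  "row m u = concat (map u [0..<m])"

lemma row_Suc: "row (Suc m) u = row m u @ u m" and row_0: "row 0 u = []"
  by (simp_all add: row_def)

lemma remdups_adj_row_cong:
  "(\<And>g. g < m \<Longrightarrow> remdups_adj (u g) = remdups_adj (u' g)) \<Longrightarrow> remdups_adj (row m u) = remdups_adj (row m u')"
  by (induction m) (auto simp: row_Suc row_0 intro!: remdups_adj_append_cong)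

lemma set_row: "set (row m u) = (\<Union>g<m. set (u g))"
  by (induction m) (auto simp: row_Suc row_0 lessThan_Suc)

lemma length_row_le: "(\<And>g. g < m \<Longrightarrow> length (u g) \<le> k) \<Longrightarrow> length (row m u) \<le> k * m"
proof (induction m)
  case (Suc m)
  then have "length (row m u) \<le> k * m" "length (u m) \<le> k" by auto
  then show ?case by (simp add: row_Suc)
qed (simp add: row_0)

lemma count_list_row: "count_list (row m u) x = (\<Sum>g<m. count_list (u g) x)"
  by (induction m) (auto simp: row_Suc row_0)

section \<open>Patterns with stars and one-star slots\<close>

definition inst :: "'a \<Rightarrow> 'a option list \<Rightarrow> 'a list" where
  "inst a p = map (\<lambda>s. case s of None \<Rightarrow> a | Some b \<Rightarrow> b) p"

lemma inst_simps [simp]: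
  "inst a [] = []" "inst a (None # p) = a # inst a p" "inst a (Some b # p) = b # inst a p"
  "inst a (map Some w) = w"
  by (simp_all add: inst_def o_def)

lemma inst_row: "inst a (row m U) = row m (\<lambda>g. inst a (U g))"
  by (simp add: inst_def row_def map_concat o_def)

lemma count_list_map_Some [simp]: "count_list (map Some w) None = 0"
  by (induction w) auto

definition nx :: "nat \<Rightarrow> nat" where
  "nx c = c mod 3 + 1"

abbreviation letters :: "nat set" where
  "letters \<equiv> {1, 2, 3}"

abbreviation symbols :: "nat option set" where
  "symbols \<equiv> insert None (Some ` letters)"

text \<open>A star between these two letters merges with a neighbour for every filling except
  \<open>c\<close>, which produces \<open>ins c\<close>.\<close>

definition gap :: "nat \<Rightarrow> nat list" where
  "gap c = [nx c, nx (nx c)]"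

definition ins :: "nat \<Rightarrow> nat list" where
  "ins c = [nx c, c, nx (nx c)]"

text \<open>The longest pieces below have the form \<open>[nx a, a, e, a, nx (nx a)]\<close>;
  \<open>15 * r\<close> pieces of length at most 5 account for the bound \<open>75 * r\<close> in
  \<open>no_lines\<close>.\<close>

definition short :: "nat list \<Rightarrow> bool" where
  "short w \<longleftrightarrow> set w \<subseteq> letters \<and> length w \<le> 5"

text \<open>A switch from \<open>u\<close> to \<open>v\<close> at the cost of one star. Fewer than
  \<open>r\<close> such switches in a row are thrown together by the letter \<open>c\<close>, giving
  two words of different colours.\<close>

definition slot :: "nat \<Rightarrow> nat list \<Rightarrow> nat list \<Rightarrow> bool" where
  "slot c u v \<longleftrightarrow> short u \<and> short v \<and> (\<exists>p. set p \<subseteq> symbols \<and> length p \<le> 5 \<and> count_list p None = 1 \<and>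
     (\<forall>a\<in>letters. remdups_adj (inst a p) = remdups_adj (if a = c then v else u)))"

lemma slotI:
  assumes "short u" "short v" "set p \<subseteq> symbols" "length p \<le> 5" "count_list p None = 1"
    "\<forall>a\<in>letters. remdups_adj (inst a p) = remdups_adj (if a = c then v else u)"
  shows "slot c u v"
  using assms unfolding slot_def by blast

lemma slot_gap: "c \<in> letters \<Longrightarrow> slot c (gap c) (ins c)"
  by (rule slotI[where p = "[Some (nx c), None, Some (nx (nx c))]"])
    (auto simp: gap_def ins_def nx_def short_def)

text \<open>
  With \<open>b = nx a\<close> and \<open>c = nx b\<close>, the pattern \<open>b a \<star> a c\<close> is filled to \<open>b a c\<close> by \<open>a\<close>, to
  \<open>b a b a c\<close> by \<open>b\<close> and to \<open>b a c a c\<close> by \<open>c\<close>. The next two lemmas reach the last two words from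
  \<open>b a c\<close> by inserting \<open>b\<close> (resp. \<open>c\<close>) and then a further \<open>a\<close>.
\<close>

lemma slot_left:
  assumes "a \<in> letters"
  shows "slot (nx a) (ins a) [nx a, a, nx a, nx (nx a)]"
    and "slot a [nx a, a, nx a, nx (nx a)] [nx a, a, nx a, a, nx (nx a)]"
proof -
  show "slot (nx a) (ins a) [nx a, a, nx a, nx (nx a)]"
    by (rule slotI[where p = "[Some (nx a), Some a, None, Some (nx (nx a))]"])
      (use assms in \<open>auto simp: ins_def nx_def short_def\<close>)
  show "slot a [nx a, a, nx a, nx (nx a)] [nx a, a, nx a, a, nx (nx a)]"
    by (rule slotI[where p = "[Some (nx a), Some a, Some (nx a), None, Some (nx (nx a))]"])
      (use assms in \<open>auto simp: nx_def short_def\<close>)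
qed

lemma slot_right:
  assumes "a \<in> letters"
  shows "slot (nx (nx a)) (ins a) [nx a, nx (nx a), a, nx (nx a)]"
    and "slot a [nx a, nx (nx a), a, nx (nx a)] [nx a, a, nx (nx a), a, nx (nx a)]"
proof -
  show "slot (nx (nx a)) (ins a) [nx a, nx (nx a), a, nx (nx a)]"
    by (rule slotI[where p = "[Some (nx a), None, Some a, Some (nx (nx a))]"])
      (use assms in \<open>auto simp: ins_def nx_def short_def\<close>)
  show "slot a [nx a, nx (nx a), a, nx (nx a)] [nx a, a, nx (nx a), a, nx (nx a)]"
    by (rule slotI[where p = "[Some (nx a), None, Some (nx (nx a)), Some a, Some (nx (nx a))]"])
      (use assms in \<open>auto simp: nx_def short_def\<close>)
qed

section \<open>Rows of gaps and their numbers of insertions modulo \<open>r\<close>\<close>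

locale no_lines =
  fixes r :: nat and F :: "nat list \<Rightarrow> nat"
  assumes r2: "2 \<le> r"
    and F_range: "F w \<in> {1..r}"
    and F_cong: "remdups_adj w = remdups_adj w' \<Longrightarrow> F w = F w'"
    and no_line: "\<And>p. set p \<subseteq> symbols \<Longrightarrow> length p \<le> 75 * r \<Longrightarrow> 1 \<le> count_list p None \<Longrightarrow>
      count_list p None < r \<Longrightarrow> \<exists>a\<in>letters. \<exists>b\<in>letters. F (inst a p) \<noteq> F (inst b p)"
begin

text \<open>The number of gaps of each kind. The counts in \<open>M_line\<close> stay below
  \<open>4 * r\<close>, which leaves \<open>r\<close> free gaps.\<close>

definition L :: nat where "L = 5 * r"
definition m :: nat where "m = 15 * r"
definition kind :: "nat \<Rightarrow> nat" where "kind g = g div L + 1"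
definition Gap :: "nat \<Rightarrow> nat set" where "Gap c = {g. g < m \<and> kind g = c}"
definition W :: "(nat \<Rightarrow> nat list) \<Rightarrow> nat" where "W u = F (row m u)"
definition cfg :: "nat set \<Rightarrow> nat \<Rightarrow> nat list" where
  "cfg G g = (if g \<in> G then ins (kind g) else gap (kind g))"

lemma Gap_eq: "c \<in> letters \<Longrightarrow> Gap c = {(c - 1) * L..<(c - 1) * L + L}"
proof -
  assume c: "c \<in> letters"
  have L0: "L > 0" and m: "m = 3 * L" using r2 by (simp_all add: L_def m_def)
  have "g div L = c - 1 \<longleftrightarrow> c - 1 \<le> g div L \<and> g div L < (c - 1) + 1" for g by auto
  then have 1: "g div L = c - 1 \<longleftrightarrow> (c - 1) * L \<le> g \<and> g < (c - 1) * L + L" for g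
    unfolding less_eq_div_iff_mult_less_eq[OF L0] div_less_iff_less_mult[OF L0] by (simp add: algebra_simps)
  have 2: "kind g = c \<longleftrightarrow> g div L = c - 1" for g using c unfolding kind_def by auto
  have 3: "(c - 1) * L + L \<le> m" using c m by auto
  have "g \<in> Gap c \<longleftrightarrow> g \<in> {(c - 1) * L..<(c - 1) * L + L}" for g
    unfolding Gap_def mem_Collect_eq 2 1 using 3 by (simp only: atLeastLessThan_iff) linarith
  then show ?thesis by blast
qed

lemma card_Gap: "c \<in> letters \<Longrightarrow> card (Gap c) = L" by (simp add: Gap_eq)

lemma finite_Gap [simp]: "finite (Gap c)" by (simp add: Gap_def)

lemma kind_letter: "g < m \<Longrightarrow> kind g \<in> letters"
proof -
  assume "g < m"
  then have "g < 3 * L" by (simp add: L_def m_def)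
  then have "g div L < 3" using less_mult_imp_div_less by blast
  then show ?thesis unfolding kind_def by auto
qed

lemma Gap_disj: "c \<noteq> d \<Longrightarrow> Gap c \<inter> Gap d = {}" by (auto simp: Gap_def)

lemma Gap_cover: "Gap 1 \<union> Gap 2 \<union> Gap 3 = {..<m}"
  using kind_letter by (auto simp: Gap_def)

lemma W_cong: "(\<And>g. g < m \<Longrightarrow> remdups_adj (u g) = remdups_adj (v g)) \<Longrightarrow> W u = W v"
  unfolding W_def by (intro F_cong remdups_adj_row_cong)

text \<open>The form of \<open>no_line\<close> for patterns given piece by piece; merging within the
  pieces is compatible with concatenation.\<close>

lemma row_pattern:
  assumes U: "\<And>g. g < m \<Longrightarrow> set (U g) \<subseteq> symbols \<and> length (U g) \<le> 5"
    and stars: "1 \<le> (\<Sum>g<m. count_list (U g) None)" "(\<Sum>g<m. count_list (U g) None) < r"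
    and eq: "\<And>a g. a \<in> letters \<Longrightarrow> g < m \<Longrightarrow> remdups_adj (inst a (U g)) = remdups_adj (u a g)"
  shows "\<exists>a\<in>letters. \<exists>b\<in>letters. W (u a) \<noteq> W (u b)"
proof -
  have "\<exists>a\<in>letters. \<exists>b\<in>letters. F (inst a (row m U)) \<noteq> F (inst b (row m U))"
  proof (rule no_line)
    show "set (row m U) \<subseteq> symbols" using U unfolding set_row by blast
    show "length (row m U) \<le> 75 * r" using length_row_le[of m U 5] U by (simp add: m_def)
  qed (use stars in \<open>simp_all add: count_list_row\<close>)
  moreover have "F (inst a (row m U)) = W (u a)" if "a \<in> letters" for a
    unfolding W_def inst_row using eq[OF that] by (intro F_cong remdups_adj_row_cong)
  ultimately show ?thesis by metis
qed

text \<open>Stars are placed exactly in the gaps of \<open>K' - K\<close>. The letter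
  \<open>c\<close> then yields the row of \<open>K'\<close> and the other letters that of
  \<open>K\<close>, so the colours differ by \<open>row_pattern\<close>.\<close>

lemma nested_slots:
  assumes D: "D \<subseteq> {..<m}" and c: "c \<in> letters"
    and sl: "\<And>g. g \<in> D \<Longrightarrow> slot c (u0 g) (u1 g)"
    and sh: "\<And>g. g < m \<Longrightarrow> g \<notin> D \<Longrightarrow> short (u0 g)"
  shows "nested_colouring r D (\<lambda>K. W (\<lambda>g. if g \<in> K then u1 g else u0 g))"
proof
  show "2 \<le> r" "finite D" using r2 D finite_subset by auto
  show "W (\<lambda>g. if g \<in> K then u1 g else u0 g) \<in> {1..r}" for K
    using F_range by (simp add: W_def)
next
  fix K K' assume K: "K \<subseteq> K'" "K' \<subseteq> D" "1 \<le> card (K' - K)" "card (K' - K) < r"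
  obtain p where p: "\<And>g. g \<in> D \<Longrightarrow> set (p g) \<subseteq> symbols \<and> length (p g) \<le> 5 \<and> count_list (p g) None = 1 \<and>
     (\<forall>a\<in>letters. remdups_adj (inst a (p g)) = remdups_adj (if a = c then u1 g else u0 g))"
    using sl unfolding slot_def by metis
  have sh': "short (u0 g)" if "g < m" for g using that sl sh unfolding slot_def by blast
  have sh1: "short (u1 g)" if "g \<in> D" for g using that sl unfolding slot_def by blast
  define U where "U = (\<lambda>g. if g \<in> K' - K then p g else map Some (if g \<in> K then u1 g else u0 g))"
  have "(\<Sum>g<m. count_list (U g) None) = (\<Sum>g<m. if g \<in> K' - K then 1 else 0)"
    using p K by (intro sum.cong) (auto simp: U_def)
  also have "\<dots> = card ({..<m} \<inter> {g \<in> K'. g \<notin> K})" by (simp add: sum.If_cases)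
  also have "{..<m} \<inter> {g \<in> K'. g \<notin> K} = K' - K" using D K by auto
  finally have cnt: "(\<Sum>g<m. count_list (U g) None) = card (K' - K)" .
  define v where "v = (\<lambda>a. if a = c then (\<lambda>g. if g \<in> K' then u1 g else u0 g) else (\<lambda>g. if g \<in> K then u1 g else u0 g))"
  have "\<exists>a\<in>letters. \<exists>b\<in>letters. W (v a) \<noteq> W (v b)"
  proof (rule row_pattern[of U])
    show "set (U g) \<subseteq> symbols \<and> length (U g) \<le> 5" if "g < m" for g
    proof (cases "g \<in> K' - K")
      case True
      then show ?thesis using p[of g] K unfolding U_def by auto
    next
      case False
      have "U g = map Some (if g \<in> K then u1 g else u0 g)" unfolding U_def by (rule if_not_P[OF False])
      moreover have "short (if g \<in> K then u1 g else u0 g)" using sh' sh1 that K by auto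
      ultimately show ?thesis unfolding short_def by auto
    qed
    show "remdups_adj (inst a (U g)) = remdups_adj (v a g)" if "a \<in> letters" "g < m" for a g
      using p[of g] that K unfolding U_def v_def by auto
  qed (use cnt K in auto)
  then obtain a b where "W (v a) \<noteq> W (v b)" by blast
  then show "W (\<lambda>g. if g \<in> K then u1 g else u0 g) \<noteq> W (\<lambda>g. if g \<in> K' then u1 g else u0 g)"
    unfolding v_def by (cases "a = c"; cases "b = c") simp_all
qed

lemma short_cfg: "g < m \<Longrightarrow> short (cfg G g)"
  using kind_letter[of g] by (auto simp: cfg_def short_def gap_def ins_def nx_def)

lemma cfg_change_one:
  assumes c: "c \<in> letters" and "G - Gap c = G' - Gap c"
    and "card (G \<inter> Gap c) mod r = card (G' \<inter> Gap c) mod r"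
    and "card (G \<inter> Gap c) + r \<le> L" "card (G' \<inter> Gap c) + r \<le> L"
  shows "W (cfg G) = W (cfg G')"
proof -
  let ?u0 = "cfg (G - Gap c)" and ?u1 = "\<lambda>g. ins (kind g)"
  interpret nested_colouring r "Gap c" "\<lambda>K. W (\<lambda>g. if g \<in> K then ?u1 g else ?u0 g)"
  proof (rule nested_slots[OF _ c])
    show "slot c (?u0 g) (?u1 g)" if "g \<in> Gap c" for g
      using that slot_gap[OF c] by (auto simp: cfg_def Gap_def)
  qed (auto simp: Gap_def short_cfg)
  have *: "W (\<lambda>g. if g \<in> H \<inter> Gap c then ?u1 g else ?u0 g) = W (cfg H)" if "H - Gap c = G - Gap c" for H
    by (rule W_cong) (use that in \<open>auto simp: cfg_def\<close>)
  show ?thesis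
    using cong_card[of "G \<inter> Gap c" "G' \<inter> Gap c"] assms card_Gap[OF c] *[of G] *[of G'] by simp
qed

text \<open>The kinds 1, 2 and 3 are adjusted in turn, through the intermediate configurations
  \<open>G1\<close> and \<open>G2\<close>.\<close>

lemma cfg_eq:
  assumes "\<And>c. c \<in> letters \<Longrightarrow> card (G \<inter> Gap c) mod r = card (G' \<inter> Gap c) mod r"
    and "\<And>c. c \<in> letters \<Longrightarrow> card (G \<inter> Gap c) + r \<le> L"
    and "\<And>c. c \<in> letters \<Longrightarrow> card (G' \<inter> Gap c) + r \<le> L"
  shows "W (cfg G) = W (cfg G')"
proof -
  define G1 where "G1 = (G - Gap 1) \<union> (G' \<inter> Gap 1)"
  define G2 where "G2 = (G1 - Gap 2) \<union> (G' \<inter> Gap 2)"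
  have d: "Gap 1 \<inter> Gap 2 = {}" "Gap 1 \<inter> Gap 3 = {}" "Gap 2 \<inter> Gap 3 = {}" by (auto simp: Gap_def)
  have i: "G1 \<inter> Gap 1 = G' \<inter> Gap 1" "G1 \<inter> Gap 2 = G \<inter> Gap 2" "G1 \<inter> Gap 3 = G \<inter> Gap 3"
    "G2 \<inter> Gap 2 = G' \<inter> Gap 2" "G2 \<inter> Gap 1 = G' \<inter> Gap 1" "G2 \<inter> Gap 3 = G \<inter> Gap 3"
    unfolding G1_def G2_def using d by blast+
  have "W (cfg G) = W (cfg G1)"
    using assms[of 1] i by (intro cfg_change_one[of 1]) (auto simp: G1_def)
  also have "\<dots> = W (cfg G2)"
    using assms[of 2] i by (intro cfg_change_one[of 2]) (auto simp: G2_def)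
  also have "\<dots> = W (cfg (G2 - Gap 3 \<union> G' \<inter> Gap 3))"
  proof (rule cfg_change_one[of 3])
    have "(G2 - Gap 3 \<union> G' \<inter> Gap 3) \<inter> Gap 3 = G' \<inter> Gap 3" by blast
    then show "card (G2 \<inter> Gap 3) mod r = card ((G2 - Gap 3 \<union> G' \<inter> Gap 3) \<inter> Gap 3) mod r"
      "card ((G2 - Gap 3 \<union> G' \<inter> Gap 3) \<inter> Gap 3) + r \<le> L"
      using assms[of 3] i by simp_all
  qed (use assms[of 3] i in auto)
  also have "\<dots> = W (cfg G')"
  proof (rule W_cong)
    fix g assume "g < m"
    then have "g \<in> Gap 1 \<or> g \<in> Gap 2 \<or> g \<in> Gap 3" using Gap_cover by blast
    then have "g \<in> G2 - Gap 3 \<union> G' \<inter> Gap 3 \<longleftrightarrow> g \<in> G'" using i d by blast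
    then show "remdups_adj (cfg (G2 - Gap 3 \<union> G' \<inter> Gap 3) g) = remdups_adj (cfg G' g)" by (simp add: cfg_def)
  qed
  finally show ?thesis .
qed

text \<open>The slot at \<open>g\<close> joins \<open>r\<close> free gaps of kind \<open>d\<close>
  in one \<open>nested_colouring\<close>, where \<open>{g}\<close> and \<open>{h}\<close> get the
  same colour by \<open>same_card\<close>; its size condition is the reason for
  \<open>r <= card E\<close>.\<close>

lemma move_insertion:
  assumes d: "d \<in> letters" and g: "g < m" and sl: "slot d s0 s1"
    and E: "E \<subseteq> Gap d" "g \<notin> E" "r \<le> card E" "h \<in> E" "\<And>x. x \<in> E \<Longrightarrow> u x = gap d"
    and sh: "\<And>x. x < m \<Longrightarrow> short (u x)"
  shows "W (u(g := s1)) = W (u(g := s0, h := ins d))"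
proof -
  let ?u0 = "u(g := s0)" and ?u1 = "\<lambda>x. if x = g then s1 else ins d"
  have finE: "finite E" using E(1) finite_Gap finite_subset by blast
  interpret nested_colouring r "insert g E" "\<lambda>K. W (\<lambda>x. if x \<in> K then ?u1 x else ?u0 x)"
  proof (rule nested_slots[OF _ d])
    show "insert g E \<subseteq> {..<m}" using E g by (auto simp: Gap_def)
    show "slot d (?u0 x) (?u1 x)" if "x \<in> insert g E" for x
      using that sl slot_gap[OF d] E by auto
  qed (use sh in auto)
  have "W (\<lambda>x. if x \<in> {g} then ?u1 x else ?u0 x) = W (\<lambda>x. if x \<in> {h} then ?u1 x else ?u0 x)"
    using E finE by (intro same_card) auto
  moreover have "(\<lambda>x. if x \<in> {g} then ?u1 x else ?u0 x) = u(g := s1)" by auto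
  moreover have "(\<lambda>x. if x \<in> {h} then ?u1 x else ?u0 x) = u(g := s0, h := ins d)" using E by auto
  ultimately show ?thesis by simp
qed

text \<open>A piece \<open>q\<close> arises from \<open>ins a\<close> by inserting \<open>d\<close>
  and then \<open>a\<close>. \<open>move_insertion\<close> undoes these one at a time in exchange
  for a plain insertion elsewhere, so one \<open>q\<close> counts as two \<open>ins a\<close> and
  one \<open>ins d\<close>.\<close>

lemma absorb:
  assumes "finite X" and a: "a \<in> letters" and d: "d \<in> letters" "d \<noteq> a"
    and sl: "slot d (ins a) mid" "slot a mid q"
    and "X \<subseteq> Gap a" "G \<inter> X = {}"
    and "card (G \<inter> Gap a) + 2 * card X + r \<le> L" "card (G \<inter> Gap d) + card X + r \<le> L"
  shows "\<exists>G'. card (G' \<inter> Gap a) = card (G \<inter> Gap a) + 2 * card X \<and>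
     card (G' \<inter> Gap d) = card (G \<inter> Gap d) + card X \<and>
     (\<forall>e. e \<noteq> a \<longrightarrow> e \<noteq> d \<longrightarrow> G' \<inter> Gap e = G \<inter> Gap e) \<and>
     W (\<lambda>g. if g \<in> X then q else cfg G g) = W (cfg G')"
  using assms(1,7-)
proof (induction X arbitrary: G)
  case empty
  show ?case by (rule exI[of _ G]) simp
next
  case (insert g X)
  have short: "short q" "short mid" "short (ins a)" using sl unfolding slot_def by auto
  have g: "g < m" "g \<in> Gap a" "g \<notin> G" using insert.prems by (auto simp: Gap_def)
  have cX: "card (insert g X) = Suc (card X)" using insert.hyps by simp
  have disj: "Gap a \<inter> Gap d = {}" using Gap_disj d by simp
  define E where "E = Gap a - (G \<inter> Gap a \<union> insert g X)"
  have "card (Gap a) - card (G \<inter> Gap a \<union> insert g X) \<le> card E"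
    unfolding E_def using insert.hyps by (intro diff_card_le_card_Diff) simp
  moreover have "card (G \<inter> Gap a \<union> insert g X) \<le> card (G \<inter> Gap a) + card (insert g X)"
    by (rule card_Un_le)
  ultimately have E: "r \<le> card E" using insert.prems(3) card_Gap[OF a] cX by linarith
  then have "E \<noteq> {}" using r2 by auto
  then obtain h where h: "h \<in> E" by blast
  define E' where "E' = Gap d - G \<inter> Gap d"
  have "card (Gap d) - card (G \<inter> Gap d) \<le> card E'"
    unfolding E'_def by (intro diff_card_le_card_Diff) simp
  then have E': "r \<le> card E'" using insert.prems(4) card_Gap[OF d(1)] by linarith
  then have "E' \<noteq> {}" using r2 by auto
  then obtain h' where h': "h' \<in> E'" by blast
  have hh: "h \<in> Gap a" "h \<notin> G" "h \<noteq> g" "h \<notin> X" "h' \<in> Gap d" "h' \<notin> G" "h' \<notin> Gap a" "h \<notin> Gap d" "g \<notin> Gap d"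
    using h h' disj g unfolding E_def E'_def by auto
  define u where "u = (\<lambda>x. if x \<in> insert g X then q else cfg G x)"
  define v where "v = (\<lambda>x. if x \<in> X then q else cfg (insert h G) x)"
  define G2 where "G2 = insert g (insert h' (insert h G))"
  have "u = u(g := q)" by (auto simp: u_def fun_eq_iff)
  then have "W u = W (u(g := q))" by (rule arg_cong)
  \<comment> \<open>The extra \<open>a\<close> moves to the free gap \<open>h\<close>; the inserted
    \<open>d\<close> then moves to \<open>h'\<close>.\<close>
  also have "\<dots> = W (u(g := mid, h := ins a))"
  proof (rule move_insertion[OF a g(1) sl(2)])
    show "E \<subseteq> Gap a" "g \<notin> E" "r \<le> card E" "h \<in> E" using E h unfolding E_def by auto
    show "u x = gap a" if "x \<in> E" for x
      using that unfolding E_def u_def cfg_def Gap_def by auto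
    show "short (u x)" if "x < m" for x using that short short_cfg unfolding u_def by auto
  qed
  also have "\<dots> = W (v(g := mid))"
    by (rule W_cong) (use hh in \<open>auto simp: u_def v_def cfg_def Gap_def\<close>)
  also have "\<dots> = W (v(g := ins a, h' := ins d))"
  proof (rule move_insertion[OF d(1) g(1) sl(1)])
    show "E' \<subseteq> Gap d" "g \<notin> E'" "r \<le> card E'" "h' \<in> E'" using E' h' hh unfolding E'_def by auto
    show "v x = gap d" if "x \<in> E'" for x
    proof -
      have "x \<in> Gap d" "x \<notin> G" "x \<noteq> h" "x \<notin> X"
        using that hh disj insert.prems(1) unfolding E'_def by auto
      then show ?thesis unfolding v_def cfg_def Gap_def by auto
    qed
    show "short (v x)" if "x < m" for x using that short short_cfg unfolding v_def by auto
  qed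
  also have "\<dots> = W (\<lambda>x. if x \<in> X then q else cfg G2 x)"
  proof (rule W_cong)
    fix x
    have "h' \<notin> X" using hh insert.prems(1) by auto
    moreover have "kind g = a" "kind h' = d" using g hh by (auto simp: Gap_def)
    ultimately show "remdups_adj ((v(g := ins a, h' := ins d)) x) = remdups_adj (if x \<in> X then q else cfg G2 x)"
      using insert.hyps by (auto simp: v_def G2_def cfg_def)
  qed
  finally have 1: "W u = W (\<lambda>x. if x \<in> X then q else cfg G2 x)" .
  have Ga: "G2 \<inter> Gap a = insert g (insert h (G \<inter> Gap a))" and Gd: "G2 \<inter> Gap d = insert h' (G \<inter> Gap d)"
    unfolding G2_def using hh g by auto
  have fin: "finite (G \<inter> Gap a)" "finite (G \<inter> Gap d)" by simp_all
  have ca: "card (G2 \<inter> Gap a) = card (G \<inter> Gap a) + 2" and cd: "card (G2 \<inter> Gap d) = card (G \<inter> Gap d) + 1"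
    unfolding Ga Gd using hh g fin by simp_all
  have "G2 \<inter> X = {}" using insert.prems(1,2) insert.hyps hh unfolding G2_def by auto
  moreover have "X \<subseteq> Gap a" using insert.prems(1) by simp
  ultimately obtain G' where G': "card (G' \<inter> Gap a) = card (G2 \<inter> Gap a) + 2 * card X"
     "card (G' \<inter> Gap d) = card (G2 \<inter> Gap d) + card X"
     "\<And>e. e \<noteq> a \<Longrightarrow> e \<noteq> d \<Longrightarrow> G' \<inter> Gap e = G2 \<inter> Gap e"
     "W (\<lambda>g. if g \<in> X then q else cfg G2 g) = W (cfg G')"
    using insert.IH[of G2] insert.prems(3,4) ca cd cX by auto
  have "G2 \<inter> Gap e = G \<inter> Gap e" if "e \<noteq> a" "e \<noteq> d" for e
    using that hh g unfolding G2_def Gap_def by auto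
  then show ?case using G' ca cd cX 1 unfolding u_def by (intro exI[of _ G']) auto
qed

text \<open>Pieces in \<open>X\<close> get a star between two letters \<open>a\<close>, those in
  \<open>P\<close> a star in an empty gap. The letter \<open>a\<close> collapses the former to
  \<open>ins a\<close>, hence \<open>X\<close> lies in \<open>G\<close>.\<close>

lemma star_pattern:
  assumes a: "a \<in> letters" and X: "X \<subseteq> G \<inter> Gap a" and P: "P \<inter> G = {}" "P \<subseteq> {..<m}"
    and card: "1 \<le> card X + card P" "card X + card P < r"
    and u: "\<And>e. u e = (\<lambda>g. if g \<in> X \<and> e \<noteq> a then [nx a, a, e, a, nx (nx a)] else cfg (G \<union> (P \<inter> Gap e)) g)"
  shows "\<exists>e\<in>letters. \<exists>f\<in>letters. W (u e) \<noteq> W (u f)"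
proof -
  define U where "U = (\<lambda>g. if g \<in> X then [Some (nx a), Some a, None, Some a, Some (nx (nx a))]
    else if g \<in> P then [Some (nx (kind g)), None, Some (nx (nx (kind g)))] else map Some (cfg G g))"
  have XP: "X \<inter> P = {}" "X \<subseteq> {..<m}" using X P by (auto simp: Gap_def)
  have fin: "finite X" "finite P" using XP P finite_subset by blast+
  have "(\<Sum>g<m. count_list (U g) None) = (\<Sum>g<m. (if g \<in> X then 1 else 0) + (if g \<in> P then 1 else 0))"
    using XP by (intro sum.cong) (auto simp: U_def)
  also have "\<dots> = card X + card P"
  proof -
    have "{..<m} \<inter> X = X" "{..<m} \<inter> P = P" using XP P by auto
    then show ?thesis by (simp add: sum.distrib flip: sum.inter_restrict)
  qed
  finally have cnt: "(\<Sum>g<m. count_list (U g) None) = card X + card P" .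
  show ?thesis
  proof (rule row_pattern[of U])
    show "set (U g) \<subseteq> symbols \<and> length (U g) \<le> 5" if g: "g < m" for g
    proof -
      have "kind g \<in> letters" "short (cfg G g)" using g kind_letter short_cfg by auto
      then show ?thesis using a unfolding U_def by (auto simp: nx_def short_def)
    qed
    show "remdups_adj (inst e (U g)) = remdups_adj (u e g)" if e: "e \<in> letters" and g: "g < m" for e g
    proof -
      have k: "kind g \<in> letters" using g kind_letter by auto
      consider "g \<in> X" | "g \<notin> X" "g \<in> P" | "g \<notin> X" "g \<notin> P" by blast
      then show ?thesis
      proof cases
        case 1
        then have "kind g = a" "g \<in> G" using X by (auto simp: Gap_def)
        then show ?thesis using 1 a e unfolding u U_def cfg_def ins_def by (auto simp: nx_def)
      next
        case 2
        then have "g \<notin> G" using P by auto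
        moreover have "g \<in> Gap e \<longleftrightarrow> kind g = e" using g by (auto simp: Gap_def)
        ultimately show ?thesis using 2 k e unfolding u U_def cfg_def ins_def gap_def by (auto simp: nx_def)
      next
        case 3
        then show ?thesis unfolding u U_def cfg_def by auto
      qed
    qed
  qed (use cnt card in auto)
qed

lemma config_exists:
  assumes "\<And>c. c \<in> letters \<Longrightarrow> v c \<le> L"
  shows "\<exists>G. \<forall>c\<in>letters. card (G \<inter> Gap c) = v c"
proof -
  have "\<exists>H. H \<subseteq> Gap c \<and> card H = v c" if "c \<in> letters" for c
    using obtain_subset_with_card_n[of "v c" "Gap c"] card_Gap[OF that] assms[OF that] by metis
  then obtain H where H: "\<And>c. c \<in> letters \<Longrightarrow> H c \<subseteq> Gap c \<and> card (H c) = v c" by metis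
  have "(\<Union>d\<in>letters. H d) \<inter> Gap c = H c" if c: "c \<in> letters" for c
  proof (intro equalityI subsetI)
    fix x assume "x \<in> (\<Union>d\<in>letters. H d) \<inter> Gap c"
    then obtain d where d: "d \<in> letters" "x \<in> H d" "x \<in> Gap c" by blast
    then have "x \<in> Gap d" using H by blast
    then have "d = c" using d(3) by (simp add: Gap_def)
    then show "x \<in> H c" using d(2) by simp
  next
    fix x assume "x \<in> H c"
    then show "x \<in> (\<Union>d\<in>letters. H d) \<inter> Gap c" using H[OF c] c by blast
  qed
  then show ?thesis using H by (intro exI[of _ "\<Union>c\<in>letters. H c"]) simp
qed

section \<open>The induced colouring of the torus\<close>

definition coords :: "nat \<Rightarrow> int \<Rightarrow> int \<Rightarrow> int \<Rightarrow> nat \<Rightarrow> int" where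
  "coords a x y z d = (if d = a then x else if d = nx a then y else z)"

text \<open>By \<open>M_eq\<close> the choice of the configuration is immaterial. The letter
  \<open>a\<close> decides whose count is the first coordinate.\<close>

definition M :: "nat \<Rightarrow> int \<Rightarrow> int \<Rightarrow> int \<Rightarrow> nat" where
  "M a x y z = W (cfg (SOME G. \<forall>c\<in>letters. card (G \<inter> Gap c) = nat (coords a x y z c mod int r)))"

lemma M_eq:
  assumes "\<And>c. c \<in> letters \<Longrightarrow> int (card (G \<inter> Gap c)) mod int r = coords a x y z c mod int r"
    and "\<And>c. c \<in> letters \<Longrightarrow> card (G \<inter> Gap c) + r \<le> L"
  shows "W (cfg G) = M a x y z"
proof -
  define v where "v = (\<lambda>c. nat (coords a x y z c mod int r))"
  have v: "v c < r" "int (v c) = coords a x y z c mod int r" for c using r2 by (simp_all add: v_def nat_less_iff)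
  have "\<exists>G. \<forall>c\<in>letters. card (G \<inter> Gap c) = v c"
  proof (rule config_exists)
    fix c show "v c \<le> L" using v(1)[of c] by (simp add: L_def)
  qed
  then have G': "\<forall>c\<in>letters. card ((SOME G. \<forall>c\<in>letters. card (G \<inter> Gap c) = v c) \<inter> Gap c) = v c"
    by (rule someI_ex)
  have "M a x y z = W (cfg (SOME G. \<forall>c\<in>letters. card (G \<inter> Gap c) = v c))"
    unfolding M_def v_def ..
  moreover have "W (cfg G) = W (cfg (SOME G. \<forall>c\<in>letters. card (G \<inter> Gap c) = v c))"
  proof (rule cfg_eq)
    fix c assume c: "c \<in> letters"
    let ?G = "SOME G. \<forall>c\<in>letters. card (G \<inter> Gap c) = v c"
    have "int (card (G \<inter> Gap c) mod r) = int (v c mod r)"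
      using assms(1)[OF c] v(2)[of c] by (simp add: zmod_int)
    then show "card (G \<inter> Gap c) mod r = card (?G \<inter> Gap c) mod r"
      by (simp only: bspec[OF G' c] of_nat_eq_iff)
    show "card (?G \<inter> Gap c) + r \<le> L" unfolding bspec[OF G' c] using v(1)[of c] by (simp add: L_def)
  qed (use assms(2) in auto)
  ultimately show ?thesis by simp
qed

text \<open>
  Here \<open>n\<close> counts the stars in patterns \<open>b a \<star> a c\<close>, and \<open>p\<close>, \<open>q\<close>, \<open>s\<close> count those in gaps where
  \<open>a\<close>, \<open>b = nx a\<close>, \<open>c = nx b\<close> can be inserted.
\<close>

lemma M_line:
  assumes a: "a \<in> letters" and card: "1 \<le> n + p + q + s" "n + p + q + s < r"
  shows "\<not> (M a (x + int p) y z = M a (x + int n) (y + int (n + q)) z \<and>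
            M a (x + int p) y z = M a (x + int n) y (z + int (n + s)))"
proof
  assume eq: "M a (x + int p) y z = M a (x + int n) (y + int (n + q)) z \<and>
            M a (x + int p) y z = M a (x + int n) y (z + int (n + s))"
  define b where "b = nx a"
  define c where "c = nx (nx a)"
  have letters: "letters = {a, b, c}"
    using a unfolding b_def c_def by (auto simp: nx_def)
  have abc: "a \<noteq> b" "a \<noteq> c" "b \<noteq> c" "b \<in> letters" "c \<in> letters"
    using a unfolding b_def c_def by (auto simp: nx_def)
  \<comment> \<open>Counts between \<open>r\<close> and \<open>2 * r - 1\<close>: large enough to
    contain \<open>n\<close> filled gaps for \<open>X\<close>, small enough to leave room within
    \<open>L\<close>.\<close>
  define v where "v = (\<lambda>d. nat (coords a x y z d mod int r) + r)"
  have v: "r \<le> v d" "v d < 2 * r" "int (v d) mod int r = coords a x y z d mod int r" for d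
    using r2 by (simp_all add: v_def nat_less_iff)
  have "v d \<le> L" for d using v(2)[of d] by (simp add: L_def)
  from config_exists[of v, OF this] obtain G where G: "\<And>d. d \<in> letters \<Longrightarrow> card (G \<inter> Gap d) = v d"
    by blast
  have free: "\<exists>H. H \<subseteq> Gap d - G \<inter> Gap d \<and> card H = k" if "d \<in> letters" "k < r" for d k
  proof -
    have "card (Gap d) - card (G \<inter> Gap d) \<le> card (Gap d - G \<inter> Gap d)"
      by (intro diff_card_le_card_Diff) simp
    then have "k \<le> card (Gap d - G \<inter> Gap d)"
      using card_Gap[OF that(1)] G[OF that(1)] v(2)[of d] that(2) by (simp add: L_def)
    then show ?thesis by (metis obtain_subset_with_card_n)
  qed
  obtain A where A: "A \<subseteq> Gap a - G \<inter> Gap a" "card A = p" using free[OF a, of p] card by auto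
  obtain B where B: "B \<subseteq> Gap b - G \<inter> Gap b" "card B = q" using free[OF abc(4), of q] card by auto
  obtain C where C: "C \<subseteq> Gap c - G \<inter> Gap c" "card C = s" using free[OF abc(5), of s] card by auto
  have "n \<le> card (G \<inter> Gap a)" using G[OF a] v(1)[of a] card by simp
  then obtain X where X: "X \<subseteq> G \<inter> Gap a" "card X = n" by (metis obtain_subset_with_card_n)
  have fin: "finite A" "finite B" "finite C" "finite X"
    using A B C X finite_Gap finite_subset by (metis Diff_subset Int_lower2 order_trans)+
  have disj: "Gap a \<inter> Gap b = {}" "Gap a \<inter> Gap c = {}" "Gap b \<inter> Gap c = {}"
    using Gap_disj abc by auto
  define P where "P = A \<union> B \<union> C"
  have P: "P \<inter> Gap a = A" "P \<inter> Gap b = B" "P \<inter> Gap c = C" "P \<inter> G = {}" "P \<subseteq> {..<m}"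
    unfolding P_def using A B C disj by (auto simp: Gap_def)
  have cardP: "card P = p + q + s"
  proof -
    have "A \<inter> B = {}" "(A \<union> B) \<inter> C = {}" using A B C disj by blast+
    then show ?thesis unfolding P_def using fin A B C by (simp add: card_Un_disjoint)
  qed
  define u where "u = (\<lambda>e g. if g \<in> X \<and> e \<noteq> a then [nx a, a, e, a, nx (nx a)] else cfg (G \<union> (P \<inter> Gap e)) g)"
  have ua: "W (u a) = M a (x + int p) y z"
  proof -
    have "u a = cfg (G \<union> A)" unfolding u_def P by simp
    moreover have "W (cfg (G \<union> A)) = M a (x + int p) y z"
    proof (rule M_eq)
      fix d assume d: "d \<in> letters"
      have "card ((G \<union> A) \<inter> Gap d) = v d + (if d = a then p else 0)"
      proof (cases "d = a")
        case True
        have "(G \<union> A) \<inter> Gap d = (G \<inter> Gap a) \<union> A" using A True by blast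
        moreover have "(G \<inter> Gap a) \<inter> A = {}" using A by blast
        ultimately show ?thesis using A(2) G[OF a] fin True by (simp add: card_Un_disjoint)
      next
        case False
        then have "(G \<union> A) \<inter> Gap d = G \<inter> Gap d" using A Gap_disj[OF False] by blast
        then show ?thesis using G[OF d] False by simp
      qed
      note cd = this
      show "card ((G \<union> A) \<inter> Gap d) + r \<le> L" using cd v(2)[of d] card by (cases "d = a") (simp_all add: L_def)
      have "int (card ((G \<union> A) \<inter> Gap d)) mod int r = (int (v d) + (if d = a then int p else 0)) mod int r"
        unfolding cd by simp
      also have "\<dots> = (coords a x y z d + (if d = a then int p else 0)) mod int r"
        using v(3)[of d] by (metis mod_add_cong)
      also have "\<dots> = coords a (x + int p) y z d mod int r" by (simp add: coords_def)
      finally show "int (card ((G \<union> A) \<inter> Gap d)) mod int r = coords a (x + int p) y z d mod int r" .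
    qed
    ultimately show ?thesis by simp
  qed
  \<comment> \<open>Removing \<open>X\<close> from \<open>G\<close> costs \<open>n\<close>
    insertions of \<open>a\<close>; \<open>absorb\<close> returns \<open>2 * n\<close> of
    \<open>a\<close> and \<open>n\<close> of \<open>d\<close>. With the \<open>k\<close> stars in
    \<open>D\<close>, the net gain is \<open>n\<close> for \<open>a\<close> and \<open>n + k\<close>
    for \<open>d\<close>.\<close>
  have ue: "W (u d) = M a x' y' z'"
    if d: "d = b \<or> d = c" and sl: "slot d (ins a) mid" "slot a mid [nx a, a, d, a, nx (nx a)]"
      and D: "D = P \<inter> Gap d" "card D = k" "k < r"
      and co: "\<And>e. e \<in> letters \<Longrightarrow> coords a x' y' z' e = coords a x y z e + (if e = a then int n else if e = d then int (n + k) else 0)"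
    for d mid D k x' y' z'
  proof -
    have da: "d \<noteq> a" "d \<in> letters" using d abc by auto
    let ?G = "(G - X) \<union> D"
    have D': "D \<subseteq> Gap d" "D \<inter> G = {}" "D \<inter> Gap a = {}" using D P Gap_disj[OF da(1)] by blast+
    have XG: "?G \<inter> Gap a = (G \<inter> Gap a) - X" using X D' by blast
    have finD: "finite D" using D' finite_Gap finite_subset by blast
    have ca: "card (?G \<inter> Gap a) + n = v a"
      unfolding XG using X fin G[OF a] card_mono[of "G \<inter> Gap a" X] by (simp add: card_Diff_subset)
    have "?G \<inter> Gap d = (G \<inter> Gap d) \<union> D" using X D' Gap_disj[OF da(1)] by blast
    moreover have "(G \<inter> Gap d) \<inter> D = {}" using D' by blast
    ultimately have cd: "card (?G \<inter> Gap d) = v d + k"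
      using G[OF da(2)] D finD by (simp add: card_Un_disjoint)
    have "\<exists>G'. card (G' \<inter> Gap a) = card (?G \<inter> Gap a) + 2 * card X \<and>
     card (G' \<inter> Gap d) = card (?G \<inter> Gap d) + card X \<and>
     (\<forall>e. e \<noteq> a \<longrightarrow> e \<noteq> d \<longrightarrow> G' \<inter> Gap e = ?G \<inter> Gap e) \<and>
     W (\<lambda>g. if g \<in> X then [nx a, a, d, a, nx (nx a)] else cfg ?G g) = W (cfg G')"
    proof (rule absorb[OF fin(4) a da(2,1) sl])
      show "X \<subseteq> Gap a" "?G \<inter> X = {}" using X D' by blast+
      show "card (?G \<inter> Gap a) + 2 * card X + r \<le> L"
        using ca X v(2)[of a] card by (simp add: L_def)
      show "card (?G \<inter> Gap d) + card X + r \<le> L"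
        using cd X v(2)[of d] card D by (simp add: L_def)
    qed
    then obtain G' where G': "card (G' \<inter> Gap a) = card (?G \<inter> Gap a) + 2 * card X"
       "card (G' \<inter> Gap d) = card (?G \<inter> Gap d) + card X"
       "\<And>e. e \<noteq> a \<Longrightarrow> e \<noteq> d \<Longrightarrow> G' \<inter> Gap e = ?G \<inter> Gap e"
       "W (\<lambda>g. if g \<in> X then [nx a, a, d, a, nx (nx a)] else cfg ?G g) = W (cfg G')" by blast
    have "u d = (\<lambda>g. if g \<in> X then [nx a, a, d, a, nx (nx a)] else cfg ?G g)"
      unfolding u_def using da D by (auto simp: cfg_def fun_eq_iff)
    then have "W (u d) = W (cfg G')" using G'(4) by simp
    also have "\<dots> = M a x' y' z'"
    proof (rule M_eq)
      fix e assume e: "e \<in> letters"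
      have ce: "card (G' \<inter> Gap e) = v e + (if e = a then n else if e = d then n + k else 0)"
      proof -
        have "card (G' \<inter> Gap a) = v a + n" using G'(1) ca X by simp
        moreover have "card (G' \<inter> Gap d) = v d + (n + k)" using G'(2) cd X by simp
        moreover have "G' \<inter> Gap e = G \<inter> Gap e" if "e \<noteq> a" "e \<noteq> d"
          using G'(3)[OF that] D' X Gap_disj[OF that(1)] Gap_disj[OF that(2)] by blast
        ultimately show ?thesis using G[OF e] by auto
      qed
      show "card (G' \<inter> Gap e) + r \<le> L" using ce v(2)[of e] card D(3) by (cases "e = a"; cases "e = d") (simp_all add: L_def)
      have "int (card (G' \<inter> Gap e)) mod int r =
          (int (v e) + (if e = a then int n else if e = d then int (n + k) else 0)) mod int r"
        unfolding ce by simp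
      also have "\<dots> = (coords a x y z e + (if e = a then int n else if e = d then int (n + k) else 0)) mod int r"
        using v(3)[of e] by (metis mod_add_cong)
      finally show "int (card (G' \<inter> Gap e)) mod int r = coords a x' y' z' e mod int r" unfolding co[OF e] .
    qed
    finally show ?thesis .
  qed
  have ub: "W (u b) = M a (x + int n) (y + int (n + q)) z"
  proof (rule ue[of b _ B q])
    show "slot b (ins a) [nx a, a, nx a, nx (nx a)]" "slot a [nx a, a, nx a, nx (nx a)] [nx a, a, b, a, nx (nx a)]"
      using slot_left[OF a] by (simp_all add: b_def)
  qed (use P B card abc in \<open>auto simp: coords_def b_def\<close>)
  have uc: "W (u c) = M a (x + int n) y (z + int (n + s))"
  proof (rule ue[of c _ C s])
    show "slot c (ins a) [nx a, nx (nx a), a, nx (nx a)]"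
      "slot a [nx a, nx (nx a), a, nx (nx a)] [nx a, a, c, a, nx (nx a)]"
      using slot_right[OF a] by (simp_all add: c_def)
    fix e assume "e \<in> letters"
    then have "e \<in> {a, b, c}" unfolding letters .
    then show "coords a (x + int n) y (z + int (n + s)) e = coords a x y z e + (if e = a then int n else if e = c then int (n + s) else 0)"
      using abc by (auto simp: coords_def b_def)
  qed (use P C card abc in auto)
  have "\<exists>e\<in>letters. \<exists>f\<in>letters. W (u e) \<noteq> W (u f)"
    by (rule star_pattern[OF a X(1) P(4,5)]) (use card cardP X in \<open>auto simp: u_def\<close>)
  then show False using ua ub uc eq unfolding letters by auto
qed

lemma dir_ok_M:
  assumes a: "a \<in> letters"
  shows "dir_ok (int r) (M a)"
  unfolding dir_ok_def
proof (intro conjI allI impI)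
  fix x y z
  show "M a x y z \<in> {1..nat (int r)}" using F_range unfolding M_def W_def by simp
  show per: "M a (x + int r) y z = M a x y z" for x y z
    unfolding M_def by (rule arg_cong[where f = "\<lambda>G. W (cfg G)"]) (simp add: coords_def if_distrib cong: if_cong)
  show "M a (x + k) y z \<noteq> M a x y z" if "0 < k" "k < int r" for k
    using M_line[OF a, of 0 "nat k" 0 0 x y z] that by auto
  show "\<not> (M a (x + i) y z = M a x (y + j) z \<and> M a (x + i) y z = M a x y (z + k))"
    if "0 < i" "0 < j" "0 < k" "i + j + k < int r" for i j k
    using M_line[OF a, of 0 "nat i" "nat j" "nat k" x y z] that by auto
  show "\<not> (M a (x + i) y z = M a x (y + j) z \<and> M a (x + i) y z = M a x y (z + k))"
    if "i < int r" "j < int r" "k < int r" "int r \<le> i + j" "int r \<le> i + k" "i + j + k < 2 * int r" for i j k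
  proof -
    \<comment> \<open>The base point becomes \<open>x + i\<close>, from which \<open>r - i\<close>
      further steps lead back to \<open>x\<close> modulo \<open>r\<close>. The number of stars is
      \<open>i + j + k - r\<close>.\<close>
    let ?n = "nat (int r - i)" and ?q = "nat (j - (int r - i))" and ?s = "nat (k - (int r - i))"
    have "x + i + int ?n = x + int r" "int (?n + ?q) = j" "int (?n + ?s) = k" using that by auto
    then show ?thesis using M_line[OF a, of ?n 0 ?q ?s "x + i" y z] that per by simp
  qed
qed

lemma odd_number_of_colours: "odd r"
proof -
  interpret latin_torus "int r" "M 1"
  proof
    show "int r \<ge> 2" using r2 by simp
    show "dir_ok (int r) (M 1)" by (rule dir_ok_M) simp
    \<comment> \<open>Rotating the coordinates amounts to changing the letter that comes
      first.\<close>
    have co: "coords 1 z x y d = coords 2 x y z d" "coords 1 y z x d = coords 3 x y z d" if "d \<in> letters" for x y z d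
      using that by (auto simp: coords_def nx_def)
    have "(\<lambda>x y z. M 1 z x y) = M 2" "(\<lambda>x y z. M 1 y z x) = M 3"
      unfolding M_def fun_eq_iff using co by simp_all
    then show "dir_ok (int r) (\<lambda>x y z. M 1 z x y)" "dir_ok (int r) (\<lambda>x y z. M 1 y z x)"
      using dir_ok_M[of 2] dir_ok_M[of 3] by (simp_all only: insert_iff simp_thms)
  qed
  show ?thesis using odd_order by simp
qed

end

section \<open>Reduction to sequences of blocks\<close>

text \<open>
  \<open>blow xs u\<close> takes the successive values \<open>u\<close> on blocks whose right endpoints are \<open>Suc x\<close> for \<open>x\<close> in \<open>xs\<close>;
  surplus breakpoints are ignored.
\<close>

fun blow :: "nat list \<Rightarrow> 'a list \<Rightarrow> nat \<Rightarrow> 'a" where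
  "blow [] u i = hd u"
| "blow (x # xs) u i = (if i \<le> Suc x \<or> tl u = [] then hd u else blow xs (tl u) i)"

lemma blow_map: "u \<noteq> [] \<Longrightarrow> blow xs (map h u) i = h (blow xs u i)"
  by (induction xs arbitrary: u) (auto simp: hd_map map_tl[symmetric])

lemma blow_in_set: "u \<noteq> [] \<Longrightarrow> blow xs u i \<in> set u"
proof (induction xs arbitrary: u)
  case (Cons x xs)
  then show ?case using Cons.IH[of "tl u"] by (auto dest: list.set_sel(2))
qed simp

lemma blow_append: "length u \<le> Suc (length ys) \<Longrightarrow> blow (ys @ zs) u i = blow ys u i"
proof (induction ys arbitrary: u)
  case Nil
  then have "tl u = []" by (cases u) auto
  then show ?case by (cases zs) auto
qed simp

lemma blow_le: "\<forall>x\<in>set xs. i \<le> Suc x \<Longrightarrow> blow xs u i = hd u"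
  by (cases xs) auto

text \<open>Merging equal neighbours deletes the breakpoint between them and leaves the function
  unchanged.\<close>

lemma blow_remdups_adj:
  assumes "sorted_wrt (<) xs" "length w = Suc (length xs)"
  shows "\<exists>ys. sorted_wrt (<) ys \<and> set ys \<subseteq> set xs \<and> length (remdups_adj w) = Suc (length ys) \<and>
    (\<forall>i. blow ys (remdups_adj w) i = blow xs w i)"
  using assms
proof (induction xs arbitrary: w)
  case Nil
  then obtain a where "w = [a]" by (cases w) auto
  then show ?case by (intro exI[of _ "[]"]) simp
next
  case (Cons x xs)
  then obtain a b w' where w: "w = a # b # w'" by (metis length_Suc_conv)
  have "length (b # w') = Suc (length xs)" "sorted_wrt (<) xs" using Cons.prems w by auto
  from Cons.IH[OF this(2,1)] obtain ys where ys: "sorted_wrt (<) ys" "set ys \<subseteq> set xs"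
    "length (remdups_adj (b # w')) = Suc (length ys)" "\<And>i. blow ys (remdups_adj (b # w')) i = blow xs (b # w') i"
    by blast
  have xs: "\<forall>y\<in>set xs. x < y" using Cons.prems by simp
  show ?case
  proof (cases "a = b")
    case True
    have "blow xs (b # w') i = blow (x # xs) w i" for i
    proof (cases "i \<le> Suc x")
      case True
      then have "\<forall>y\<in>set xs. i \<le> Suc y" using xs by fastforce
      then show ?thesis using blow_le[of xs i "b # w'"] True w \<open>a = b\<close> by simp
    qed (use True w in simp)
    then show ?thesis using ys True w by (intro exI[of _ ys]) auto
  next
    case False
    then have r: "remdups_adj w = a # remdups_adj (b # w')" using w by simp
    have "sorted_wrt (<) (x # ys)" using ys xs by auto
    moreover have "blow (x # ys) (remdups_adj w) i = blow (x # xs) w i" for i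
      unfolding r using ys(4)[of i] w by simp
    ultimately show ?thesis using ys r by (intro exI[of _ "x # ys"]) auto
  qed
qed

text \<open>Each block with value \<open>s\<close> is one interval, nonempty because the breakpoints
  increase strictly within range. The free left end \<open>lo\<close> serves the induction.\<close>

lemma blow_intervals:
  assumes "sorted_wrt (<) xs" "length p = Suc (length xs)" "\<forall>x\<in>set xs. lo \<le> Suc x \<and> Suc x < n" "1 \<le> lo" "lo \<le> n"
  shows "\<exists>\<F>. finite \<F> \<and> card \<F> \<le> count_list p s \<and> (\<forall>I\<in>\<F>. interval_of n I) \<and>
     {i \<in> {lo..n}. blow xs p i = s} = \<Union>\<F> \<and> (s \<in> set p \<longrightarrow> \<F> \<noteq> {})"
  using assms
proof (induction xs arbitrary: p lo)
  case Nil
  then obtain a where p: "p = [a]" by (cases p) auto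
  show ?case
  proof (cases "a = s")
    case True
    then show ?thesis using p Nil by (intro exI[of _ "{{lo..n}}"]) (auto simp: interval_of_def)
  next
    case False
    then show ?thesis using p by (intro exI[of _ "{}"]) auto
  qed
next
  case (Cons x xs)
  then obtain a b p' where p: "p = a # b # p'" by (metis length_Suc_conv)
  have x: "lo \<le> Suc x" "Suc x < n" "\<forall>y\<in>set xs. x < y" using Cons.prems by auto
  obtain \<F> where F: "finite \<F>" "card \<F> \<le> count_list (b # p') s" "\<forall>I\<in>\<F>. interval_of n I"
     "{i \<in> {Suc (Suc x)..n}. blow xs (b # p') i = s} = \<Union>\<F>" "s \<in> set (b # p') \<Longrightarrow> \<F> \<noteq> {}"
    using Cons.IH[of "b # p'" "Suc (Suc x)"] Cons.prems p x by (auto simp: Suc_le_eq)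
  have split: "{i \<in> {lo..n}. blow (x # xs) p i = s} =
      (if a = s then {lo..Suc x} else {}) \<union> {i \<in> {Suc (Suc x)..n}. blow xs (b # p') i = s}"
    using p x by (auto simp: not_le Suc_le_eq)
  show ?case
  proof (cases "a = s")
    case True
    have "interval_of n {lo..Suc x}" using x Cons.prems unfolding interval_of_def by (metis less_imp_le)
    moreover have "card (insert {lo..Suc x} \<F>) \<le> count_list p s"
      using F(1,2) card_insert_le_m1 p True by (simp add: card_insert_if)
    ultimately show ?thesis using F True p unfolding split
      by (intro exI[of _ "insert {lo..Suc x} \<F>"]) auto
  next
    case False
    then show ?thesis using F p unfolding split by (intro exI[of _ \<F>]) auto
  qed
qed

lemma blow_in_words:
  "u \<noteq> [] \<Longrightarrow> set u \<subseteq> letters \<Longrightarrow> (\<lambda>i\<in>{1..n}. blow xs u i) \<in> words 3 n"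
proof -
  assume "u \<noteq> []" "set u \<subseteq> letters"
  then have "blow xs u i \<in> {1..3}" for i using blow_in_set[of u xs i] by auto
  then show ?thesis unfolding words_def by (intro restrict_PiE_iff[THEN iffD2] ballI)
qed

lemma fill_blow:
  "p \<noteq> [] \<Longrightarrow> fill n (\<lambda>i\<in>{1..n}. blow xs p i) a = (\<lambda>i\<in>{1..n}. blow xs (inst a p) i)"
  unfolding fill_def inst_def by (auto simp: blow_map fun_eq_iff)

text \<open>A \<open>T\<close>-set of breakpoints is coloured by its whole table of colours of
  blown-up words. On a homogeneous set the table is constant, so after merging the remaining
  breakpoints do not matter.\<close>

lemma ramsey_reduced_pattern:
  fixes T r :: nat
  assumes "1 \<le> r"
  shows "\<exists>N\<ge>1. \<forall>n\<ge>N. \<forall>c \<in> words 3 n \<rightarrow> {1..r}. \<exists>F xs.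
    (\<forall>w. F w \<in> {1..r}) \<and> (\<forall>w w'. remdups_adj w = remdups_adj w' \<longrightarrow> F w = F w') \<and>
    sorted_wrt (<) xs \<and> length xs = T \<and> (\<forall>x\<in>set xs. Suc x < n) \<and>
    (\<forall>w. w \<noteq> [] \<longrightarrow> set w \<subseteq> letters \<longrightarrow> length w \<le> Suc T \<longrightarrow>
       c (\<lambda>i\<in>{1..n}. blow (take (length w - 1) xs) w i) = F w)"
proof -
  define Ls where "Ls = {u :: nat list. set u \<subseteq> letters \<and> length u \<le> Suc T} - {[]}"
  define Col where "Col = Ls \<rightarrow>\<^sub>E {1..r}"
  have "finite Ls" unfolding Ls_def using finite_lists_length_le[of letters "Suc T"] by simp
  then have "finite Col" unfolding Col_def by (intro finite_PiE) auto
  then obtain e where e: "bij_betw e Col {0..<card Col}" using ex_bij_betw_finite_nat by blast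
  \<comment> \<open>The first \<open>T\<close> of the \<open>2 * T\<close> homogeneous points become
    \<open>xs\<close>; the others pad shorter lists.\<close>
  obtain N0 :: nat where N0: "partn_lst {..<N0} (replicate (card Col) (2 * T)) T"
    using ramsey_full by blast
  show ?thesis
  \<comment> \<open>Breakpoints lie below \<open>N0\<close>, so \<open>Suc x < n\<close> and the
    last block is nonempty.\<close>
  proof (intro exI[of _ "Suc N0"] conjI allI impI ballI)
    fix n c assume n: "Suc N0 \<le> n" and c: "c \<in> words 3 n \<rightarrow> {1..r}"
    define wd where "wd = (\<lambda>xs u. c (\<lambda>i\<in>{1..n}. blow xs u i))"
    define f where "f = (\<lambda>X. e (\<lambda>u\<in>Ls. wd (sorted_list_of_set X) u))"
    have wd: "wd xs u \<in> {1..r}" if "u \<in> Ls" for xs u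
      using funcset_mem[OF c blow_in_words] that unfolding wd_def Ls_def by simp
    then have col: "(\<lambda>u\<in>Ls. wd xs u) \<in> Col" for xs unfolding Col_def by auto
    have "f \<in> nsets {..<N0} T \<rightarrow> {..<card Col}"
      unfolding f_def using col bij_betw_apply[OF e] by fastforce
    then obtain i H where i: "i < card Col" and H: "H \<in> nsets {..<N0} (replicate (card Col) (2 * T) ! i)"
      "f ` nsets H T \<subseteq> {i}"
      using partn_lstE[OF N0] by (metis length_replicate)
    define hs where "hs = sorted_list_of_set H"
    have H': "H \<subseteq> {..<N0}" "finite H" "card H = 2 * T" using H i by (auto simp: nsets_def)
    have hs: "sorted_wrt (<) hs" "set hs = H" "length hs = 2 * T"
      unfolding hs_def using H' by simp_all
    define xs where "xs = take T hs"
    have xs: "sorted_wrt (<) xs" "length xs = T" "set xs \<subseteq> H"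
      unfolding xs_def using hs set_take_subset[of T hs] by (auto intro: sorted_wrt_take)
    \<comment> \<open>Padding \<open>ys\<close> by later points \<open>zs\<close> of
      \<open>H\<close> gives \<open>T\<close> breakpoints with the same table as \<open>xs\<close>;
      the surplus ones do not affect the blow-up of \<open>u\<close>.\<close>
    have hom: "wd ys u = wd xs u" if ys: "sorted_wrt (<) ys" "set ys \<subseteq> set xs" "length ys \<le> T"
      and u: "u \<in> Ls" "length u \<le> Suc (length ys)" for ys u
    proof -
      define zs where "zs = take (T - length ys) (drop T hs)"
      have "sorted_wrt (<) (take T hs @ drop T hs)" using hs by simp
      then have "\<forall>x\<in>set xs. \<forall>z\<in>set (drop T hs). x < z" "sorted_wrt (<) (drop T hs)"
        unfolding sorted_wrt_append xs_def by blast+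
      then have s: "sorted_wrt (<) (ys @ zs)"
        unfolding sorted_wrt_append zs_def using ys set_take_subset[of "T - length ys" "drop T hs"]
        by (auto intro: sorted_wrt_take)
      have len: "length (ys @ zs) = T" using ys hs by (simp add: zs_def)
      have sub: "set (ys @ zs) \<subseteq> H"
        using ys xs hs set_take_subset[of "T - length ys" "drop T hs"] set_drop_subset[of T hs]
        unfolding zs_def by auto
      have eq: "e (\<lambda>u\<in>Ls. wd l u) = i"
        if l: "sorted_wrt (<) l" "length l = T" "set l \<subseteq> H" for l
      proof -
        have "distinct l" "sorted l" using l(1) by (auto simp: strict_sorted_iff)
        then have "set l \<in> nsets H T" "sorted_list_of_set (set l) = l"
          using l by (auto simp: nsets_def distinct_card sorted_list_of_set.idem_if_sorted_distinct)
        moreover from this(1) have "f (set l) = i" using H(2) by blast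
        ultimately show ?thesis unfolding f_def by simp
      qed
      have "e (\<lambda>u\<in>Ls. wd (ys @ zs) u) = e (\<lambda>u\<in>Ls. wd xs u)"
        using eq[OF s len sub] eq[OF xs] by simp
      then have "(\<lambda>u\<in>Ls. wd (ys @ zs) u) = (\<lambda>u\<in>Ls. wd xs u)"
        using bij_betw_imp_inj_on[OF e] col by (auto dest: inj_onD)
      then have "wd (ys @ zs) u = wd xs u" using u(1) by (metis restrict_apply')
      moreover have "wd (ys @ zs) u = wd ys u" unfolding wd_def blow_append[OF u(2)] ..
      ultimately show ?thesis by simp
    qed
    \<comment> \<open>The default 1 keeps \<open>F\<close> within the colours for words that do not
      merge into \<open>Ls\<close>.\<close>
    define F where "F = (\<lambda>w. if remdups_adj w \<in> Ls then wd xs (remdups_adj w) else 1)"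
    have main: "wd (take (length w - 1) xs) w = F w"
      if w: "w \<noteq> []" "set w \<subseteq> letters" "length w \<le> Suc T" for w
    proof -
      have "sorted_wrt (<) (take (length w - 1) xs)" "length w = Suc (length (take (length w - 1) xs))"
        using xs w by (auto intro: sorted_wrt_take)
      from blow_remdups_adj[OF this] obtain ys where ys: "sorted_wrt (<) ys"
        "set ys \<subseteq> set (take (length w - 1) xs)" "length (remdups_adj w) = Suc (length ys)"
        "\<And>i. blow ys (remdups_adj w) i = blow (take (length w - 1) xs) w i" by blast
      have L: "remdups_adj w \<in> Ls"
        using w le_trans[OF remdups_adj_length w(3)] unfolding Ls_def by simp
      have "wd ys (remdups_adj w) = wd xs (remdups_adj w)"
      proof (rule hom[OF ys(1) _ _ L])
        show "set ys \<subseteq> set xs" using ys(2) set_take_subset[of "length w - 1" xs] by blast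
        show "length ys \<le> T" using L ys(3) unfolding Ls_def by simp
      qed (use ys(3) in simp)
      moreover have "wd ys (remdups_adj w) = wd (take (length w - 1) xs) w"
        unfolding wd_def ys(4) ..
      ultimately show ?thesis using L unfolding F_def by simp
    qed
    show "\<exists>F xs. (\<forall>w. F w \<in> {1..r}) \<and> (\<forall>w w'. remdups_adj w = remdups_adj w' \<longrightarrow> F w = F w') \<and>
      sorted_wrt (<) xs \<and> length xs = T \<and> (\<forall>x\<in>set xs. Suc x < n) \<and>
      (\<forall>w. w \<noteq> [] \<longrightarrow> set w \<subseteq> letters \<longrightarrow> length w \<le> Suc T \<longrightarrow>
       c (\<lambda>i\<in>{1..n}. blow (take (length w - 1) xs) w i) = F w)"
    proof (intro exI[of _ F] exI[of _ xs] conjI allI impI ballI)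
      show "F w \<in> {1..r}" for w using wd assms unfolding F_def by auto
      show "F w = F w'" if "remdups_adj w = remdups_adj w'" for w w' using that unfolding F_def by simp
      show "Suc x < n" if "x \<in> set xs" for x
        using that xs(3) H'(1) n by fastforce
      show "c (\<lambda>i\<in>{1..n}. blow (take (length w - 1) xs) w i) = F w"
        if "w \<noteq> []" "set w \<subseteq> letters" "length w \<le> Suc T" for w
        using main[OF that] unfolding wd_def .
    qed (use xs in auto)
  qed simp
qed

hide_const (open) Ramsey.monochromatic

theorem theorem1p2:
  fixes r :: nat
  assumes "even r" and "r \<ge> 2"
  shows "\<exists>N. \<forall>n\<ge>N. \<forall>c \<in> words 3 n \<rightarrow> {1..r}.
           \<exists>l \<in> star_words 3 n.
             monochromatic c (comb_line 3 n l) \<and>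
             union_of_at_most_intervals (r - 1) n (active n l)"
proof -
  obtain N where N: "N \<ge> 1" and ramsey: "\<And>n c. n \<ge> N \<Longrightarrow> c \<in> words 3 n \<rightarrow> {1..r} \<Longrightarrow> \<exists>F xs.
    (\<forall>w. F w \<in> {1..r}) \<and> (\<forall>w w'. remdups_adj w = remdups_adj w' \<longrightarrow> F w = F w') \<and>
    sorted_wrt (<) xs \<and> length xs = 75 * r \<and> (\<forall>x\<in>set xs. Suc x < n) \<and>
    (\<forall>w. w \<noteq> [] \<longrightarrow> set w \<subseteq> letters \<longrightarrow> length w \<le> Suc (75 * r) \<longrightarrow>
       c (\<lambda>i\<in>{1..n}. blow (take (length w - 1) xs) w i) = F w)"
    using ramsey_reduced_pattern[of r "75 * r"] assms(2) by auto
  show ?thesis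
  proof (intro exI[of _ N] allI impI ballI, rule ccontr)
    fix n c assume n: "N \<le> n" and c: "c \<in> words 3 n \<rightarrow> {1..r}"
      and no: "\<not> (\<exists>l \<in> star_words 3 n. monochromatic c (comb_line 3 n l) \<and>
             union_of_at_most_intervals (r - 1) n (active n l))"
    obtain F xs where F: "\<And>w. F w \<in> {1..r}" "\<And>w w'. remdups_adj w = remdups_adj w' \<Longrightarrow> F w = F w'"
      and xs: "sorted_wrt (<) xs" "length xs = 75 * r" "\<And>x. x \<in> set xs \<Longrightarrow> Suc x < n"
      and cF: "\<And>w. w \<noteq> [] \<Longrightarrow> set w \<subseteq> letters \<Longrightarrow> length w \<le> Suc (75 * r) \<Longrightarrow>
        c (\<lambda>i\<in>{1..n}. blow (take (length w - 1) xs) w i) = F w"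
      using ramsey[OF n c] by blast
    interpret no_lines r F
    proof
      show "2 \<le> r" by (rule assms(2))
      show "F w \<in> {1..r}" for w by (rule F(1))
      show "F w = F w'" if "remdups_adj w = remdups_adj w'" for w w' by (rule F(2)[OF that])
      fix p :: "nat option list"
      assume p: "set p \<subseteq> symbols" "length p \<le> 75 * r" "1 \<le> count_list p None" "count_list p None < r"
      show "\<exists>a\<in>letters. \<exists>b\<in>letters. F (inst a p) \<noteq> F (inst b p)"
      proof (rule ccontr)
        \<comment> \<open>Blown up along the first \<open>length p - 1\<close> breakpoints, such a
          pattern becomes a forbidden line \<open>l\<close>.\<close>
        assume all: "\<not> (\<exists>a\<in>letters. \<exists>b\<in>letters. F (inst a p) \<noteq> F (inst b p))"
        have None: "None \<in> set p"
          using p(3) count_notin[of None p] by (cases "None \<in> set p") simp_all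
        then have "p \<noteq> []" by auto
        define ys where "ys = take (length p - 1) xs"
        define l where "l = (\<lambda>i\<in>{1..n}. blow ys p i)"
        have ys: "sorted_wrt (<) ys" "length p = Suc (length ys)" "\<forall>x\<in>set ys. 1 \<le> Suc x \<and> Suc x < n"
          unfolding ys_def using xs \<open>p \<noteq> []\<close> p(2) set_take_subset[of "length p - 1" xs]
          by (auto intro: sorted_wrt_take)
        have "1 \<le> n" using N n by simp
        from blow_intervals[OF ys order.refl this, of None] obtain \<F> where
          \<F>: "finite \<F>" "card \<F> \<le> count_list p None" "\<forall>I\<in>\<F>. interval_of n I"
             "{i \<in> {1..n}. blow ys p i = None} = \<Union>\<F>" "\<F> \<noteq> {}" using None by blast
        have active: "active n l = \<Union>\<F>"
          unfolding \<F>(4)[symmetric] active_def l_def by auto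
        have "\<Union>\<F> \<noteq> {}" using \<F>(3,5) unfolding interval_of_def by fastforce
        then obtain j where j: "j \<in> {1..n}" "l j = None" unfolding active[symmetric] active_def by blast
        have "l \<in> star_words 3 n" unfolding star_words_def
        proof
          have "blow ys p i \<in> insert None (Some ` {1..3})" for i
            using blow_in_set[OF \<open>p \<noteq> []\<close>, of ys i] p(1) by auto
          then show "l \<in> {1..n} \<rightarrow>\<^sub>E insert None (Some ` {1..3})" unfolding l_def by auto
          show "l \<notin> {1..n} \<rightarrow>\<^sub>E Some ` {1..3}"
          proof
            assume "l \<in> {1..n} \<rightarrow>\<^sub>E Some ` {1..3}"
            then have "l j \<in> Some ` {1..3}" using j(1) by (rule PiE_mem)
            then show False using j(2) by auto
          qed
        qed
        moreover have "monochromatic c (comb_line 3 n l)"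
        proof -
          have "c (fill n l a) = F (inst a p)" if "a \<in> letters" for a
          proof -
            have "set (inst a p) \<subseteq> letters" using p(1) that unfolding inst_def by auto
            moreover have "inst a p \<noteq> []" "length (inst a p) = length p" using \<open>p \<noteq> []\<close> by (auto simp: inst_def)
            ultimately have "c (\<lambda>i\<in>{1..n}. blow ys (inst a p) i) = F (inst a p)"
              using cF[of "inst a p"] p(2) unfolding ys_def by simp
            then show ?thesis unfolding l_def fill_blow[OF \<open>p \<noteq> []\<close>] .
          qed
          moreover have "F (inst a p) = F (inst 1 p)" if "a \<in> letters" for a
            using all that by blast
          ultimately have "c (fill n l a) = F (inst 1 p)" if "a \<in> letters" for a
            using that by metis
          moreover have "{1..3} = letters" by auto
          ultimately have "\<forall>w\<in>comb_line 3 n l. c w = F (inst 1 p)"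
            unfolding comb_line_def by blast
          then show ?thesis unfolding Defs.monochromatic_def ..
        qed
        \<comment> \<open>Each star contributes at most one interval, and there are at most
          \<open>r - 1\<close> stars.\<close>
        moreover have "union_of_at_most_intervals (r - 1) n (active n l)"
          unfolding union_of_at_most_intervals_def active using \<F> p(4) by (intro exI[of _ \<F>]) auto
        ultimately show False using no by blast
      qed
    qed
    show False using odd_number_of_colours assms(1) by simp
  qed
qed

end
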